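(* Let $\mathbf H$ be a finite connected ordered hypergraph and let $S,T$ be constructs of $\mathbf H$. If $S\leq_{\mathit{GFO}}T$ (generalised flip order), then $S\leq_{\mathit{FWO}}T$ (facial weak order).
   Context: A (finite) hypergraph $\mathbf H$ with finite vertex set $H$ is a set of non-empty subsets of $H$ (hyperedges) with $\bigcup\mathbf H=H$ and $\{x\}\in\mathbf H$ for all $x\in H$. For $X\subseteq H$, $\mathbf H_X:=\{Z\in\mathbf H: Z\subseteq X\}$ and $\mathbf H\setminus X:=\mathbf H_{H\setminus X}$. $\mathbf H$ is connected if there is no partition $H=X_1\cup X_2$ into two non-empty parts with $\mathbf H=\mathbf H_{X_1}\cup\mathbf H_{X_2}$. $\mathbf H,X\leadsto H_1,\dots,H_n$ means that $\mathbf H_{H_1},\dots,\mathbf H_{H_n}$ are the connected components of $\mathbf H\setminus X$. Constructs of a connected hypergraph $\mathbf H$ are non-planar rooted trees with nodes labelled by non-empty subsets of $H$, defined recursively: the one-node tree labelled $H$ is a construct of $\mathbf H$; if $\emptyset\neq Y\subsetneq H$, $\mathbf H,Y\leadsto H_1,\dots,H_n$, and $T_i$ is a construct of $\mathbf H_{H_i}$ for each $i$, then the tree $Y(T_1,\dots,T_n)$ with root $Y$ and immediate subtrees $T_1,\dots,T_n$ is a construct of $\mathbf H$. Nodes are identified with their labels. A construction is a construct all of whose nodes are singletons. $\mathbf H$ is ordered if $H$ carries a total order; $Y<Z$ (or $Z>Y$) means $\max Y<\min Z$. If in a construct $S$ the node $X$ is the parent of the node $Y$, contracting the edge between them and labelling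 the merged node $X\cup Y$ yields a construct $T$; write $S\subset_{X,Y}T$, and say that $S$ is a facet of $T$. $S\subseteq T$ means that $T$ is obtained from $S$ by a (possibly empty) sequence of edge contractions. Generalised flip order: $S\lessdot S'$ iff there exist $U,V$ with $U>V$ such that either $S\subset_{U,V}S'$ (fusion) or $S'\subset_{V,U}S$ (split); $\leq_{\mathit{GFO}}$ is the reflexive and transitive closure of $\lessdot$. Flip order: let $S$ be a construction of $\mathbf H$ with $\{x\}$ the parent of $\{y\}$ and $y<x$. Let $G$ be the union of the labels of $\{x\}$ and all its descendants in $S$, and $\mathbf G=\mathbf H_G$. The subtree of $S$ rooted at $\{x\}$ consists of $x$, its child $y$, and, for each connected component $C$ of $\mathbf G\setminus\{x,y\}$, a construction $S_C$ of $\mathbf G_C$. $\mathsf{Flip}_S(x,y)$ is obtained from $S$ by replacing this subtree with the one having root $\{y\}$, whose children are: a node $\{x\}$, carrying as immediate subtrees those $S_C$ with $C$ contained in the component of $\mathbf G\setminus\{y\}$ containing $x$; and all the remaining $S_C$. The flip order $\le_{\mathrm{flip}}$ is the partial order on constructions that is the reflexive transitive closure of the relation $S\mapsto\mathsf{Flip}_S(x,y)$ (so $S\le_{\mathrm{flip}}\mathsf{Flip}_S(x,y)$). Facial weak order: for a construct $S$, let $\max\{S\}$ and $\min\{S\}$ be the maximum and minimum, for $\le_{\mathrm{flip}}$, of the set of constructions $T$ with $T\subseteq S$. Write $S\lessdot_{\mathit{FWO}}T$ iff either $S$ is a facet of $T$, $\min\{S\}=\min\{T\}$ and $\max\{S\}<_{\mathrm{flip}}\max\{T\}$;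 or $T$ is a facet of $S$, $\max\{S\}=\max\{T\}$ and $\min\{S\}<_{\mathrm{flip}}\min\{T\}$. Then $\leq_{\mathit{FWO}}$ is the reflexive and transitive closure of $\lessdot_{\mathit{FWO}}$. *)

theory Defs
  imports Main "HOL-Library.FSet"
begin

text \<open>A hypergraph is given by its set of hyperedges; its vertex set is the union \<open>\<Union>H\<close>.
  The total order on the vertices is the one of the type class \<open>linorder\<close>.\<close>

definition hypergraph :: "'a set set \<Rightarrow> bool" where
  "hypergraph H \<longleftrightarrow> finite (\<Union>H) \<and> {} \<notin> H \<and> (\<forall>x\<in>\<Union>H. {x} \<in> H)"

definition hg_restrict :: "'a set set \<Rightarrow> 'a set \<Rightarrow> 'a set set" where
  "hg_restrict H X = {Z \<in> H. Z \<subseteq> X}"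

definition hg_minus :: "'a set set \<Rightarrow> 'a set \<Rightarrow> 'a set set" where
  "hg_minus H X = hg_restrict H (\<Union>H - X)"

definition hg_connected :: "'a set set \<Rightarrow> bool" where
  "hg_connected H \<longleftrightarrow>
     \<not> (\<exists>X1 X2. X1 \<noteq> {} \<and> X2 \<noteq> {} \<and> X1 \<inter> X2 = {} \<and> X1 \<union> X2 = \<Union>H \<and>
              H = hg_restrict H X1 \<union> hg_restrict H X2)"

text \<open>The vertex sets of the connected components.\<close>

definition hg_components :: "'a set set \<Rightarrow> 'a set set" where
  "hg_components H =
     {C. C \<noteq> {} \<and> C \<subseteq> \<Union>H \<and> hg_connected (hg_restrict H C) \<and>
         (\<forall>D. C \<subseteq> D \<and> D \<subseteq> \<Union>H \<and> hg_connected (hg_restrict H D) \<longrightarrow> D = C)}"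

text \<open>Non-planar rooted trees. The immediate subtrees form a finite set; no multiplicities are
  needed, because distinct subtrees of a construct carry disjoint non-empty labels.\<close>

datatype 'a ltree = Node "'a set" "'a ltree fset"

primrec nodes :: "'a ltree \<Rightarrow> 'a set set" where
  "nodes (Node Y ts) = insert Y (\<Union>(fset (nodes |`| ts)))"

definition support :: "'a ltree \<Rightarrow> 'a set" where
  "support T = \<Union>(nodes T)"

text \<open>In \<open>graft\<close>, \<open>f\<close> chooses the construct grafted on each connected component.\<close>

inductive construct :: "'a set set \<Rightarrow> 'a ltree \<Rightarrow> bool" where
  single: "\<Union>H \<noteq> {} \<Longrightarrow> construct H (Node (\<Union>H) {||})"
| graft: "\<lbrakk>Y \<noteq> {}; Y \<subset> \<Union>H;
           \<And>C. C \<in> hg_components (hg_minus H Y) \<Longrightarrow> construct (hg_restrict H C) (f C);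
           fset ts = f ` hg_components (hg_minus H Y)\<rbrakk>
          \<Longrightarrow> construct H (Node Y ts)"

definition construction :: "'a set set \<Rightarrow> 'a ltree \<Rightarrow> bool" where
  "construction H S \<longleftrightarrow> construct H S \<and> (\<forall>X\<in>nodes S. is_singleton X)"

text \<open>\<open>contracts X Y S T\<close> is \<open>S \<subset>\<^bsub>X,Y\<^esub> T\<close>.\<close>

inductive contracts :: "'a set \<Rightarrow> 'a set \<Rightarrow> 'a ltree \<Rightarrow> 'a ltree \<Rightarrow> bool" for X Y where
  root: "Node Y us |\<in>| ts \<Longrightarrow>
    contracts X Y (Node X ts) (Node (X \<union> Y) (us |\<union>| (ts |-| {|Node Y us|})))"
| subtree: "\<lbrakk>t |\<in>| ts; contracts X Y t t'\<rbrakk> \<Longrightarrow>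
    contracts X Y (Node Z ts) (Node Z (finsert t' (ts |-| {|t|})))"

definition facet :: "'a ltree \<Rightarrow> 'a ltree \<Rightarrow> bool" where
  "facet S T \<longleftrightarrow> (\<exists>X Y. contracts X Y S T)"

definition face :: "'a ltree \<Rightarrow> 'a ltree \<Rightarrow> bool" where
  "face = facet\<^sup>*\<^sup>*"

text \<open>Only meaningful for non-empty finite sets, as node labels of constructs are.\<close>

definition set_less :: "'a::linorder set \<Rightarrow> 'a set \<Rightarrow> bool" where
  "set_less Y Z \<longleftrightarrow> Max Y < Min Z"

definition gfo_step :: "'a::linorder set set \<Rightarrow> 'a ltree \<Rightarrow> 'a ltree \<Rightarrow> bool" where
  "gfo_step H S S' \<longleftrightarrow> construct H S \<and> construct H S' \<and>
     (\<exists>U V. set_less V U \<and> (contracts U V S S' \<or> contracts V U S' S))"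

definition gfo :: "'a::linorder set set \<Rightarrow> 'a ltree \<Rightarrow> 'a ltree \<Rightarrow> bool" where
  "gfo H = (gfo_step H)\<^sup>*\<^sup>*"

text \<open>\<open>flips H x y S S'\<close> states that \<open>S'\<close> is \<open>Flip\<^sub>S(x,y)\<close>. In \<open>root\<close>, the elements of \<open>cs\<close> are the
  constructions \<open>S\<^sub>C\<close> of the connected components \<open>C\<close> (the support of \<open>S\<^sub>C\<close>) of \<open>H\<^sub>G\<close> without \<open>x, y\<close>.\<close>

inductive flips :: "'a set set \<Rightarrow> 'a \<Rightarrow> 'a \<Rightarrow> 'a ltree \<Rightarrow> 'a ltree \<Rightarrow> bool" for H x y where
  root: "\<lbrakk>Node {y} us |\<in>| ts;
          cs = us |\<union>| (ts |-| {|Node {y} us|});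
          G = support (Node {x} ts);
          K \<in> hg_components (hg_minus (hg_restrict H G) {y}); x \<in> K\<rbrakk> \<Longrightarrow>
    flips H x y (Node {x} ts)
      (Node {y} (finsert (Node {x} (ffilter (\<lambda>c. support c \<subseteq> K) cs))
                         (ffilter (\<lambda>c. \<not> support c \<subseteq> K) cs)))"
| subtree: "\<lbrakk>t |\<in>| ts; flips H x y t t'\<rbrakk> \<Longrightarrow>
    flips H x y (Node Z ts) (Node Z (finsert t' (ts |-| {|t|})))"

definition flip_step :: "'a::linorder set set \<Rightarrow> 'a ltree \<Rightarrow> 'a ltree \<Rightarrow> bool" where
  "flip_step H S S' \<longleftrightarrow> construction H S \<and> (\<exists>x y. y < x \<and> flips H x y S S')"

definition flip_le :: "'a::linorder set set \<Rightarrow> 'a ltree \<Rightarrow> 'a ltree \<Rightarrow> bool" where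
  "flip_le H = (flip_step H)\<^sup>*\<^sup>*"

definition flip_less :: "'a::linorder set set \<Rightarrow> 'a ltree \<Rightarrow> 'a ltree \<Rightarrow> bool" where
  "flip_less H S T \<longleftrightarrow> flip_le H S T \<and> S \<noteq> T"

definition constructions_below :: "'a set set \<Rightarrow> 'a ltree \<Rightarrow> 'a ltree set" where
  "constructions_below H S = {T. construction H T \<and> face T S}"

text \<open>\<open>flip_max H S M\<close> and \<open>flip_min H S M\<close> state that \<open>max{S}\<close>, respectively \<open>min{S}\<close>, exists
  and is \<open>M\<close>; so the facial weak order below never compares unspecified values.\<close>

definition flip_max :: "'a::linorder set set \<Rightarrow> 'a ltree \<Rightarrow> 'a ltree \<Rightarrow> bool" where
  "flip_max H S M \<longleftrightarrow>
     M \<in> constructions_below H S \<and> (\<forall>T\<in>constructions_below H S. flip_le H T M)"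

definition flip_min :: "'a::linorder set set \<Rightarrow> 'a ltree \<Rightarrow> 'a ltree \<Rightarrow> bool" where
  "flip_min H S M \<longleftrightarrow>
     M \<in> constructions_below H S \<and> (\<forall>T\<in>constructions_below H S. flip_le H M T)"

definition fwo_step :: "'a::linorder set set \<Rightarrow> 'a ltree \<Rightarrow> 'a ltree \<Rightarrow> bool" where
  "fwo_step H S T \<longleftrightarrow> construct H S \<and> construct H T \<and>
     (\<exists>minS maxS minT maxT.
        flip_min H S minS \<and> flip_max H S maxS \<and> flip_min H T minT \<and> flip_max H T maxT \<and>
        (facet S T \<and> minS = minT \<and> flip_less H maxS maxT \<or>
         facet T S \<and> maxS = maxT \<and> flip_less H minS minT))"

definition fwo :: "'a::linorder set set \<Rightarrow> 'a ltree \<Rightarrow> 'a ltree \<Rightarrow> bool" where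
  "fwo H = (fwo_step H)\<^sup>*\<^sup>*"

end

theory Submission
  imports Defs
begin

text \<open>
  A construct is determined by a rule \<open>c\<close> that selects the root label from the support of each
  subtree, and it suffices to consider coherent rules, which take the greatest vertices for a total
  preorder. If \<open>S\<close> has rule \<open>c\<close>, then the constructs below \<open>S\<close> are exactly those whose labels are
  contained in what \<open>c\<close> selects (\<open>compat\<close>). So always taking \<open>Min\<close> of what \<open>c\<close> selects gives a
  construction below \<open>S\<close>, and it is \<open>max{S}\<close>: given a construction \<open>T\<close> below \<open>S\<close>, make the subtrees
  below its root extreme by induction, flip the root with the child that carries the desired
  vertex, and make the subtrees extreme again. Dually, \<open>Max\<close> gives \<open>min{S}\<close>.
  If \<open>S \<subset>\<^bsub>U,V\<^esub> T\<close> with \<open>V < U\<close>, then \<open>Max\<close> of any subset of \<open>U \<union> V\<close> that meets \<open>U\<close> lies in \<open>U\<close>, so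
  \<open>min{T}\<close> lies below \<open>S\<close> and equals \<open>min{S}\<close>; but \<open>Min (U \<union> V)\<close> lies in \<open>V\<close>, so \<open>max{T}\<close> does
  not lie below \<open>S\<close>. Splits are dual.
\<close>

section \<open>Trees\<close>

lemma support_Node: "support (Node Y ts) = Y \<union> (\<Union>t\<in>fset ts. support t)"
  unfolding support_def by auto

section \<open>Subtrees and the choice rules that produce their labels\<close>

primrec subtrees :: "'a ltree \<Rightarrow> 'a ltree set" where
  "subtrees (Node Y ts) = insert (Node Y ts) (\<Union>(fset (subtrees |`| ts)))"

text \<open>A rule sees only the vertex set of a subtree, so one and the same rule can be read on
  trees of different shape, such as a construct and its faces.\<close>

definition exact :: "('a set \<Rightarrow> 'a set) \<Rightarrow> 'a ltree \<Rightarrow> bool" where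
  "exact c T \<longleftrightarrow> (\<forall>Y ts. Node Y ts \<in> subtrees T \<longrightarrow> Y = c (support (Node Y ts)))"

definition compat :: "('a set \<Rightarrow> 'a set) \<Rightarrow> 'a ltree \<Rightarrow> bool" where
  "compat c T \<longleftrightarrow> (\<forall>Y ts. Node Y ts \<in> subtrees T \<longrightarrow> Y \<subseteq> c (support (Node Y ts)))"

lemma subtrees_self: "T \<in> subtrees T"
  by (cases T) simp

lemma subtree_support: "t \<in> subtrees T \<Longrightarrow> support t \<subseteq> support T"
proof (induction T)
  case (Node Y ts)
  show ?case
  proof (cases "t = Node Y ts")
    case False
    then obtain u where "u |\<in>| ts" "t \<in> subtrees u" using Node.prems by auto
    then have "support t \<subseteq> support u" "support u \<subseteq> support (Node Y ts)"
      using Node.IH[of u] unfolding support_Node by blast+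
    then show ?thesis by blast
  qed simp
qed

lemma subtrees_Node: "subtrees (Node Y ts) = insert (Node Y ts) (\<Union>t\<in>fset ts. subtrees t)"
  by simp

lemma exact_Node:
  "exact c (Node Y ts) \<longleftrightarrow> Y = c (support (Node Y ts)) \<and> (\<forall>t\<in>fset ts. exact c t)"
  unfolding exact_def subtrees_Node insert_iff UN_iff ltree.inject by metis

lemma compat_Node:
  "compat c (Node Y ts) \<longleftrightarrow> Y \<subseteq> c (support (Node Y ts)) \<and> (\<forall>t\<in>fset ts. compat c t)"
  unfolding compat_def subtrees_Node insert_iff UN_iff ltree.inject by metis

lemma exact_imp_compat: "exact c T \<Longrightarrow> compat c T"
  unfolding exact_def compat_def by blast

lemma exact_cong:
  assumes "\<And>D. D \<subseteq> support T \<Longrightarrow> c D = c' D"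
  shows "exact c T \<longleftrightarrow> exact c' T"
  using assms subtree_support[of _ T] unfolding exact_def by metis

section \<open>Supports and tubes under contraction\<close>

lemma contracts_support: "contracts X Y S T \<Longrightarrow> support T = support S"
proof (induction rule: contracts.induct)
  case (root us ts)
  have "support (Node X ts) = X \<union> (support (Node Y us) \<union> (\<Union>t\<in>fset ts - {Node Y us}. support t))"
    using root unfolding support_Node[of X] by blast
  then show ?case unfolding support_Node by auto
next
  case (subtree t ts t' Z)
  have "support (Node Z ts) = Z \<union> (support t \<union> (\<Union>t\<in>fset ts - {t}. support t))"
    using subtree.hyps(1) unfolding support_Node by blast
  then show ?case using subtree.IH unfolding support_Node by auto
qed

lemma contracts_label_subset: "contracts X Y S T \<Longrightarrow> X \<union> Y \<subseteq> support S"
proof (induction rule: contracts.induct)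
  case (root us ts)
  then show ?case by (force simp: support_Node)
next
  case (subtree t ts t' Z)
  then show ?case by (force simp: support_Node)
qed

text \<open>The family of nested vertex sets, or tubing, that a construct encodes. Contraction can
  only lose tubes, which lets \<open>greedy_not_face\<close> find the support of a merged node again
  in a construction below.\<close>

definition tubes :: "'a ltree \<Rightarrow> 'a set set" where
  "tubes T = support ` subtrees T"

lemma tubes_Node: "tubes (Node Y ts) = insert (support (Node Y ts)) (\<Union>t\<in>fset ts. tubes t)"
  unfolding tubes_def by (simp add: image_UN)

lemma contracts_tubes: "contracts X Y S T \<Longrightarrow> tubes T \<subseteq> tubes S"
proof (induction rule: contracts.induct)
  case (root us ts)
  have "support (Node (X \<union> Y) (us |\<union>| (ts |-| {|Node Y us|}))) = support (Node X ts)"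
    using contracts_support[OF contracts.root[OF root]] .
  moreover have "(\<Union>u\<in>fset us. tubes u) \<subseteq> tubes (Node Y us)" unfolding tubes_Node by blast
  moreover have "tubes (Node Y us) \<subseteq> (\<Union>t\<in>fset ts. tubes t)" using root by blast
  ultimately show ?case unfolding tubes_Node[of X] tubes_Node[of "X \<union> Y"] by auto
next
  case (subtree t ts t' Z)
  have "support (Node Z (finsert t' (ts |-| {|t|}))) = support (Node Z ts)"
    using contracts_support[OF contracts.subtree[OF subtree.hyps]] .
  moreover have "tubes t' \<subseteq> (\<Union>u\<in>fset ts. tubes u)" using subtree by blast
  ultimately show ?case unfolding tubes_Node by auto
qed

lemma face_tubes: "face S T \<Longrightarrow> tubes T \<subseteq> tubes S"
  unfolding face_def
proof (induction rule: rtranclp_induct)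
  case (step T U)
  then obtain X Y where "contracts X Y T U" by (auto simp: facet_def)
  then show ?case using step.IH contracts_tubes by blast
qed simp

text \<open>Coherent choices are those that take the greatest elements for some total preorder.\<close>

definition coherent :: "('a set \<Rightarrow> 'a set) \<Rightarrow> bool" where
  "coherent c \<longleftrightarrow> (\<forall>C. c C \<subseteq> C) \<and> (\<forall>C. finite C \<and> C \<noteq> {} \<longrightarrow> c C \<noteq> {}) \<and>
     (\<forall>C D. C \<subseteq> D \<and> c D \<inter> C \<noteq> {} \<longrightarrow> c C = c D \<inter> C)"

lemma coherentD:
  assumes "coherent c"
  shows "c C \<subseteq> C" "finite C \<Longrightarrow> C \<noteq> {} \<Longrightarrow> c C \<noteq> {}"
    "C \<subseteq> D \<Longrightarrow> c D \<inter> C \<noteq> {} \<Longrightarrow> c C = c D \<inter> C"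
proof -
  note c = assms[unfolded coherent_def, THEN conjunct1]
    assms[unfolded coherent_def, THEN conjunct2, THEN conjunct1]
    assms[unfolded coherent_def, THEN conjunct2, THEN conjunct2]
  show "c C \<subseteq> C" by (rule c(1)[rule_format])
  show "finite C \<Longrightarrow> C \<noteq> {} \<Longrightarrow> c C \<noteq> {}" by (rule c(2)[rule_format], rule conjI)
  show "C \<subseteq> D \<Longrightarrow> c D \<inter> C \<noteq> {} \<Longrightarrow> c C = c D \<inter> C"
    by (rule c(3)[rule_format], rule conjI)
qed

lemma coherentI:
  assumes "\<And>C. c C \<subseteq> C" "\<And>C. finite C \<Longrightarrow> C \<noteq> {} \<Longrightarrow> c C \<noteq> {}"
    "\<And>C D. C \<subseteq> D \<Longrightarrow> c D \<inter> C \<noteq> {} \<Longrightarrow> c C = c D \<inter> C"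
  shows "coherent c"
  unfolding coherent_def
proof (intro conjI allI impI)
  fix C show "c C \<subseteq> C" by (rule assms(1))
next
  fix C :: "'a set" assume "finite C \<and> C \<noteq> {}"
  then show "c C \<noteq> {}" using assms(2)[of C] by simp
next
  fix C D :: "'a set" assume "C \<subseteq> D \<and> c D \<inter> C \<noteq> {}"
  then show "c C = c D \<inter> C" using assms(3)[of C D] by (elim conjE)
qed

text \<open>Only the child that gets merged needs an argument. The set chosen at its parent meets
  its support, since it contains \<open>Y\<close>; by coherence the choice at the child is that set
  cut down to the child's support, and this still contains \<open>Y\<close>.\<close>

lemma contracts_compat:
  assumes "coherent c" "contracts X Y S T" "compat c T"
  shows "compat c S"
  using assms(2,3)
proof (induction rule: contracts.induct)
  case (root us ts)
  have sup: "support (Node (X \<union> Y) (us |\<union>| (ts |-| {|Node Y us|}))) = support (Node X ts)"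
    using contracts_support[OF contracts.root[OF root(1)]] .
  have XY: "X \<union> Y \<subseteq> c (support (Node X ts))"
    using root(2) unfolding compat_Node sup by blast
  have sub: "support (Node Y us) \<subseteq> support (Node X ts)"
    using root(1) unfolding support_Node[of X] by blast
  have "Y \<subseteq> c (support (Node Y us))"
  \<comment> \<open>Labels of arbitrary trees may be empty, and coherence applies only if the chosen
    set meets the child.\<close>
  proof (cases "Y = {}")
    case False
    have Y: "Y \<subseteq> support (Node Y us)" by (simp add: support_Node)
    then have "c (support (Node Y us)) = c (support (Node X ts)) \<inter> support (Node Y us)"
      using coherentD(3)[OF assms(1) sub] XY False by blast
    then show ?thesis using XY Y by blast
  qed simp
  then have "compat c (Node Y us)" using root(2) by (auto simp: compat_Node)
  then show ?case using root(2) XY by (auto simp: compat_Node[of _ X] compat_Node[of _ "X \<union> Y"])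
next
  case (subtree t ts t' Z)
  have "support (Node Z (finsert t' (ts |-| {|t|}))) = support (Node Z ts)"
    using contracts_support[OF contracts.subtree[OF subtree.hyps]] .
  then show ?case using subtree by (auto simp: compat_Node)
qed

lemma face_compat:
  assumes "coherent c" "face S T" "compat c T"
  shows "compat c S"
  using assms(2,3) unfolding face_def
  by (induction rule: converse_rtranclp_induct)
    (auto simp: facet_def dest: contracts_compat[OF assms(1)])

text \<open>The total preorder is encoded by ranks: greater rank means nearer to the root, and
  vertices that tie for the top of a support share a node.\<close>

definition top_by :: "('a \<Rightarrow> nat) \<Rightarrow> 'a set \<Rightarrow> 'a set" where
  "top_by p C = {v \<in> C. \<forall>w\<in>C. p w \<le> p v}"

lemma coherent_top_by: "coherent (top_by p)"
proof -
  have "top_by p C \<noteq> {}" if "finite C" "C \<noteq> {}" for C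
  proof -
    have "Max (p ` C) \<in> p ` C" using that by (intro Max_in) auto
    then obtain v where "v \<in> C" "p v = Max (p ` C)" by (metis imageE)
    then have "v \<in> top_by p C" unfolding top_by_def using that by auto
    then show ?thesis by blast
  qed
  moreover have "top_by p C = top_by p D \<inter> C" if CD: "C \<subseteq> D" and ne: "top_by p D \<inter> C \<noteq> {}" for C D
  proof -
    obtain v where "v \<in> C" "\<forall>w\<in>D. p w \<le> p v" using ne unfolding top_by_def by blast
    then show ?thesis using CD unfolding top_by_def by (auto intro: order_trans)
  qed
  moreover have "top_by p C \<subseteq> C" for C unfolding top_by_def by blast
  ultimately show ?thesis by (intro coherentI)
qed

text \<open>In terms of preorders, \<open>focus W\<close> breaks ties in favour of \<open>W\<close>.\<close>

definition focus :: "'a set \<Rightarrow> ('a set \<Rightarrow> 'a set) \<Rightarrow> 'a set \<Rightarrow> 'a set" where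
  "focus W c C = (if c C \<inter> W = {} then c C else c C \<inter> W)"

lemma coherent_focus:
  assumes "coherent c"
  shows "coherent (focus W c)"
proof -
  have "focus W c C = focus W c D \<inter> C" if CD: "C \<subseteq> D" and ne: "focus W c D \<inter> C \<noteq> {}" for C D
  proof -
    have "c D \<inter> C \<noteq> {}" using ne unfolding focus_def by (auto split: if_splits)
    then have "c C = c D \<inter> C" using coherentD(3)[OF assms CD] by blast
    then show ?thesis using ne unfolding focus_def by (auto split: if_splits)
  qed
  moreover have "focus W c C \<subseteq> C" for C
    using coherentD(1)[OF assms] unfolding focus_def by auto
  moreover have "focus W c C \<noteq> {}" if "finite C" "C \<noteq> {}" for C
    using coherentD(2)[OF assms] that unfolding focus_def by auto
  ultimately show ?thesis by (intro coherentI)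
qed

section \<open>Contraction as a refinement of the choice rule\<close>

lemma exact_focus_disjoint:
  assumes "coherent c" "support T \<inter> W = {}"
  shows "exact (focus W c) T \<longleftrightarrow> exact c T"
proof (rule exact_cong)
  fix D assume "D \<subseteq> support T"
  then have "c D \<inter> W = {}" using assms coherentD(1)[of c D] by blast
  then show "focus W c D = c D" by (simp add: focus_def)
qed

text \<open>The disjointness of labels in a construct, stated for bare trees because induction on
  \<open>contracts\<close> descends into subtrees without reference to a hypergraph;
  \<open>con_separated\<close> supplies it for constructs.\<close>

inductive separated :: "'a ltree \<Rightarrow> bool" where
  "\<lbrakk>Y \<noteq> {}; \<And>t. t |\<in>| ts \<Longrightarrow> separated t \<and> Y \<inter> support t = {};
    \<And>t u. t |\<in>| ts \<Longrightarrow> u |\<in>| ts \<Longrightarrow> t \<noteq> u \<Longrightarrow> support t \<inter> support u = {}\<rbrakk>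
   \<Longrightarrow> separated (Node Y ts)"

lemma separatedD:
  assumes "separated (Node Y ts)"
  shows "Y \<noteq> {}" "t |\<in>| ts \<Longrightarrow> separated t" "t |\<in>| ts \<Longrightarrow> Y \<inter> support t = {}"
    "t |\<in>| ts \<Longrightarrow> u |\<in>| ts \<Longrightarrow> t \<noteq> u \<Longrightarrow> support t \<inter> support u = {}"
  using assms by (cases rule: separated.cases; blast)+

text \<open>Labels are disjoint, so each label of \<open>T\<close> either is
  \<open>X \<union> Y\<close> or misses it, and focusing on \<open>X \<union> Y\<close> changes no
  choice made in \<open>T\<close>. A further focus on \<open>X\<close> affects only the merged node:
  its support now yields \<open>X\<close>, while the support of the child, which misses
  \<open>X\<close>, still yields \<open>Y\<close> by coherence.\<close>

lemma contracts_exact: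
  assumes c: "coherent c"
  defines "c0 W \<equiv> focus W c" and "c1 W X \<equiv> focus X (focus W c)"
  assumes "contracts X Y S T" "exact c T" "separated S"
  shows "exact (c0 (X \<union> Y)) T \<and> exact (c1 (X \<union> Y) X) S"
  using assms(4-)
proof (induction rule: contracts.induct)
  case (root us ts)
  let ?W = "X \<union> Y" and ?t = "Node Y us" and ?S = "Node X ts"
  let ?T = "Node ?W (us |\<union>| (ts |-| {|?t|}))"
  note cf = coherent_focus[OF c]
  note sepS = separatedD[OF root(3)]
  note sept = separatedD[OF sepS(2)[OF root(1)]]
  have sup: "support ?T = support ?S"
    using contracts_support[OF contracts.root[OF root(1)]] .
  have cG: "c (support ?S) = ?W" using root(2) unfolding exact_Node sup by simp
  have X: "X \<noteq> {}" and Y: "Y \<noteq> {}" using sepS(1) sept(1) by auto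
  have supt: "support ?t \<subseteq> support ?S" using root(1) unfolding support_Node[of X] by blast
  have Yt: "Y \<subseteq> support ?t" by (simp add: support_Node)
  have Xt: "X \<inter> support ?t = {}" using sepS(3)[OF root(1)] .
  have dis: "support u \<inter> ?W = {}" if "u |\<in>| us |\<union>| (ts |-| {|?t|})" for u
  proof (cases "u |\<in>| us")
    case True
    then have "support u \<subseteq> support ?t" by (auto simp: support_Node)
    then show ?thesis using Xt sept(3)[OF True] by blast
  next
    case False
    then have u: "u |\<in>| ts" "u \<noteq> ?t" using that by auto
    then show ?thesis using sepS(3)[OF u(1)] sepS(4)[OF u(1) root(1) u(2)] Yt by blast
  qed
  have ex0: "exact (c0 ?W) u" and ex1: "exact (c1 ?W X) u"
    if "u |\<in>| us |\<union>| (ts |-| {|?t|})" for u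
  proof -
    have u: "exact c u" using root(2) that unfolding exact_Node[of c "?W"] by blast
    have d: "support u \<inter> ?W = {}" "support u \<inter> X = {}" using dis[OF that] by auto
    show "exact (c0 ?W) u" using exact_focus_disjoint[OF c d(1)] u unfolding c0_def by simp
    then show "exact (c1 ?W X) u"
      using exact_focus_disjoint[OF cf d(2)] unfolding c0_def c1_def by blast
  qed
  have "c0 ?W (support ?S) = ?W" using cG X unfolding c0_def focus_def by auto
  then have A: "exact (c0 ?W) ?T" using ex0 unfolding exact_Node[of _ ?W] sup by simp
  have "c (support ?t) = ?W \<inter> support ?t"
    using coherentD(3)[OF c supt] cG Y Yt by auto
  then have "c (support ?t) = Y" using Yt Xt by blast
  then have "c1 ?W X (support ?t) = Y"
    using Yt Xt unfolding c1_def focus_def by auto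
  then have t: "exact (c1 ?W X) ?t" using ex1 unfolding exact_Node[of _ Y] by simp
  have "c1 ?W X (support ?S) = X" using cG X unfolding c1_def focus_def by auto
  then have "exact (c1 ?W X) ?S" using ex1 t unfolding exact_Node[of _ X] by auto
  then show ?case using A by blast
next
  case (subtree t ts t' Z)
  let ?W = "X \<union> Y" and ?S = "Node Z ts" and ?T = "Node Z (finsert t' (ts |-| {|t|}))"
  note cf = coherent_focus[OF c]
  note sep = separatedD[OF subtree.prems(2)]
  have sup: "support ?T = support ?S"
    using contracts_support[OF contracts.subtree[OF subtree.hyps]] .
  have W: "?W \<subseteq> support t" using contracts_label_subset[OF subtree.hyps(2)] .
  have cG: "c (support ?S) = Z" and t': "exact c t'"
    using subtree.prems(1) unfolding exact_Node[of _ Z] sup by auto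
  have IH: "exact (c0 ?W) t'" "exact (c1 ?W X) t"
    using subtree.IH[OF t' sep(2)[OF subtree.hyps(1)]] by auto
  have ZW: "Z \<inter> ?W = {}" using sep(3)[OF subtree.hyps(1)] W by blast
  have 0: "c0 ?W (support ?S) = Z" "c1 ?W X (support ?S) = Z"
    using ZW cG unfolding c0_def c1_def focus_def by auto
  have ex: "exact (c0 ?W) u \<and> exact (c1 ?W X) u" if u: "u |\<in>| ts" "u \<noteq> t" for u
  proof -
    have d: "support u \<inter> ?W = {}" "support u \<inter> X = {}"
      using sep(4)[OF u(1) subtree.hyps(1) u(2)] W by auto
    have "exact c u" using subtree.prems(1) u unfolding exact_Node[of _ Z] by auto
    then show ?thesis
      using exact_focus_disjoint[OF c d(1)] exact_focus_disjoint[OF cf d(2)]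
      unfolding c0_def c1_def by blast
  qed
  have "exact (c0 ?W) ?T" using 0 IH ex unfolding exact_Node[of _ Z] sup by auto
  moreover have "exact (c1 ?W X) ?S" using 0 IH ex unfolding exact_Node[of _ Z] by auto
  ultimately show ?case by blast
qed

section \<open>Components of restrictions of a hypergraph\<close>

locale finite_hypergraph =
  fixes H :: "'a set set"
  assumes hypergraph: "hypergraph H"
begin

definition conn :: "'a set \<Rightarrow> bool" where
  "conn C \<longleftrightarrow> hg_connected (hg_restrict H C)"

definition comps :: "'a set \<Rightarrow> 'a set set" where
  "comps G = hg_components (hg_restrict H G)"

lemma finite_vertices: "finite (\<Union>H)"
  using hypergraph unfolding hypergraph_def by blast

lemma finite_subset_vertices: "G \<subseteq> \<Union>H \<Longrightarrow> finite G"
  using finite_vertices finite_subset by blast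

lemma Union_restrict: "G \<subseteq> \<Union>H \<Longrightarrow> \<Union>(hg_restrict H G) = G"
  using hypergraph unfolding hypergraph_def hg_restrict_def by fastforce

lemma restrict_restrict: "C \<subseteq> G \<Longrightarrow> hg_restrict (hg_restrict H G) C = hg_restrict H C"
  unfolding hg_restrict_def by blast

lemma minus_restrict: "G \<subseteq> \<Union>H \<Longrightarrow> hg_minus (hg_restrict H G) Y = hg_restrict H (G - Y)"
  unfolding hg_minus_def using Union_restrict[of G] restrict_restrict[of "G - Y" G] by simp

lemma conn_iff:
  assumes "C \<subseteq> \<Union>H"
  shows "conn C \<longleftrightarrow> \<not> (\<exists>A B. A \<noteq> {} \<and> B \<noteq> {} \<and> A \<inter> B = {} \<and> A \<union> B = C \<and>
    (\<forall>e\<in>H. e \<subseteq> C \<longrightarrow> e \<subseteq> A \<or> e \<subseteq> B))"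
proof -
  have "hg_restrict H C = hg_restrict (hg_restrict H C) A \<union> hg_restrict (hg_restrict H C) B
    \<longleftrightarrow> (\<forall>e\<in>H. e \<subseteq> C \<longrightarrow> e \<subseteq> A \<or> e \<subseteq> B)" for A B
    unfolding hg_restrict_def by auto
  then show ?thesis unfolding conn_def hg_connected_def Union_restrict[OF assms] by (simp only:)
qed

lemma connI:
  assumes "C \<subseteq> \<Union>H"
    and "\<And>A B. \<lbrakk>A \<inter> B = {}; A \<union> B = C; \<forall>e\<in>H. e \<subseteq> C \<longrightarrow> e \<subseteq> A \<or> e \<subseteq> B\<rbrakk> \<Longrightarrow> A = {} \<or> B = {}"
  shows "conn C"
proof -
  have False if "A \<noteq> {}" "B \<noteq> {}" "A \<inter> B = {}" "A \<union> B = C"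
    "\<forall>e\<in>H. e \<subseteq> C \<longrightarrow> e \<subseteq> A \<or> e \<subseteq> B" for A B
    using assms(2)[OF that(3-5)] that(1,2) by simp
  then show ?thesis unfolding conn_iff[OF assms(1)] by (intro notI, elim exE conjE)
qed

lemma connD:
  assumes "conn C" "C \<subseteq> \<Union>H" "A \<inter> B = {}" "A \<union> B = C" "\<forall>e\<in>H. e \<subseteq> C \<longrightarrow> e \<subseteq> A \<or> e \<subseteq> B"
  shows "A = {} \<or> B = {}"
proof (rule ccontr)
  assume "\<not> ?thesis"
  then have "A \<noteq> {} \<and> B \<noteq> {} \<and> A \<inter> B = {} \<and> A \<union> B = C \<and>
    (\<forall>e\<in>H. e \<subseteq> C \<longrightarrow> e \<subseteq> A \<or> e \<subseteq> B)" using assms(3-5) by simp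
  then show False using assms(1) unfolding conn_iff[OF assms(2)] by (elim notE, intro exI)
qed

lemma conn_singleton:
  assumes "x \<in> \<Union>H"
  shows "conn {x}"
proof (rule connI)
  show "{x} \<subseteq> \<Union>H" using assms by blast
  show "A = {} \<or> B = {}" if "A \<inter> B = {}" "A \<union> B = {x}" for A B
  proof -
    have "A \<subseteq> {x}" "B \<subseteq> {x}" using that(2) by auto
    then have "A = {} \<or> A = {x}" "B = {} \<or> B = {x}" by (simp_all only: subset_singleton_iff)
    then show ?thesis using that(1) by auto
  qed
qed

text \<open>A separation of the union restricts to one of \<open>A\<close> and one of
  \<open>B\<close>, so each of the two lies on a single side; a common vertex puts them on the same
  side.\<close>

lemma conn_Un:
  assumes A: "conn A" "A \<subseteq> \<Union>H" and B: "conn B" "B \<subseteq> \<Union>H" and AB: "A \<inter> B \<noteq> {}"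
  shows "conn (A \<union> B)"
proof -
  have "P = {} \<or> Q = {}"
    if PQ: "P \<inter> Q = {}" "P \<union> Q = A \<union> B" and e: "\<forall>e\<in>H. e \<subseteq> A \<union> B \<longrightarrow> e \<subseteq> P \<or> e \<subseteq> Q" for P Q
  proof -
    have split: "C \<inter> P = {} \<or> C \<inter> Q = {}" if C: "conn C" "C \<subseteq> \<Union>H" "C \<subseteq> A \<union> B" for C
    proof -
      have "(C \<inter> P) \<inter> (C \<inter> Q) = {}" "(C \<inter> P) \<union> (C \<inter> Q) = C" using PQ C(3) by auto
      moreover have "\<forall>e\<in>H. e \<subseteq> C \<longrightarrow> e \<subseteq> C \<inter> P \<or> e \<subseteq> C \<inter> Q" using e C(3) by fastforce
      ultimately show ?thesis by (rule connD[OF C(1,2)])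
    qed
    have "A \<inter> P = {} \<or> A \<inter> Q = {}" "B \<inter> P = {} \<or> B \<inter> Q = {}"
      using split[of A] split[of B] A B by auto
    then show ?thesis using PQ AB by blast
  qed
  then show ?thesis using A B by (intro connI) auto
qed

lemma comps_iff:
  assumes "G \<subseteq> \<Union>H"
  shows "C \<in> comps G \<longleftrightarrow> C \<noteq> {} \<and> C \<subseteq> G \<and> conn C \<and>
    (\<forall>D. C \<subseteq> D \<longrightarrow> D \<subseteq> G \<longrightarrow> conn D \<longrightarrow> D = C)"
  unfolding comps_def hg_components_def conn_def mem_Collect_eq Union_restrict[OF assms]
  using restrict_restrict[of _ G] by (metis (full_types))

lemma compsD:
  assumes "C \<in> comps G" "G \<subseteq> \<Union>H"
  shows "C \<noteq> {}" "C \<subseteq> G" "conn C" "C \<subseteq> \<Union>H"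
  using assms(1) assms(2) unfolding comps_iff[OF assms(2)] by auto

lemma comps_maximal:
  assumes "C \<in> comps G" "G \<subseteq> \<Union>H" "C \<subseteq> D" "D \<subseteq> G" "conn D"
  shows "D = C"
  using assms(1,3-) unfolding comps_iff[OF assms(2)] by simp

lemma compsI:
  assumes "G \<subseteq> \<Union>H" "C \<noteq> {}" "C \<subseteq> G" "conn C"
    "\<And>D. C \<subseteq> D \<Longrightarrow> D \<subseteq> G \<Longrightarrow> conn D \<Longrightarrow> D = C"
  shows "C \<in> comps G"
  unfolding comps_iff[OF assms(1)] using assms(2-) by simp

lemma finite_comps: "G \<subseteq> \<Union>H \<Longrightarrow> finite (comps G)"
  by (rule finite_subset[of _ "Pow G"]) (auto dest: compsD simp: finite_subset_vertices)

lemma conn_in_comps: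
  assumes A: "conn A" "A \<noteq> {}" "A \<subseteq> G" and G: "G \<subseteq> \<Union>H"
  obtains C where "C \<in> comps G" "A \<subseteq> C"
proof -
  let ?S = "{D. D \<subseteq> G \<and> conn D}"
  have "finite ?S"
    by (rule finite_subset[of _ "Pow G"]) (auto simp: finite_subset_vertices[OF G])
  then obtain C where C: "C \<in> ?S" "A \<subseteq> C" "\<forall>D\<in>?S. C \<le> D \<longrightarrow> C = D"
    using finite_has_maximal2[of ?S A] A by blast
  then have "C \<in> comps G" using A(2) by (intro compsI[OF G]) auto
  then show ?thesis using that C(2) by blast
qed

lemma comps_cover:
  assumes "x \<in> G" "G \<subseteq> \<Union>H"
  obtains C where "C \<in> comps G" "x \<in> C"
  using conn_in_comps[OF conn_singleton, of x G] assms by blast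

lemma comps_disjoint:
  assumes "C \<in> comps G" "D \<in> comps G" "C \<inter> D \<noteq> {}" and G: "G \<subseteq> \<Union>H"
  shows "C = D"
proof -
  note C = compsD[OF assms(1) G] and D = compsD[OF assms(2) G]
  have "conn (C \<union> D)" using conn_Un C D assms(3) by blast
  moreover have "C \<union> D \<subseteq> G" "C \<subseteq> C \<union> D" "D \<subseteq> C \<union> D" using C D by auto
  ultimately have "C \<union> D = C" "C \<union> D = D"
    using comps_maximal[OF assms(1) G] comps_maximal[OF assms(2) G] by auto
  then show ?thesis by simp
qed

lemma Union_comps: "G \<subseteq> \<Union>H \<Longrightarrow> \<Union>(comps G) = G"
  by (auto dest: compsD elim: comps_cover)

lemma conn_subset_comp:
  assumes "conn A" "A \<subseteq> G" "A \<inter> C \<noteq> {}" "C \<in> comps G" and G: "G \<subseteq> \<Union>H"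
  shows "A \<subseteq> C"
proof -
  obtain D where D: "D \<in> comps G" "A \<subseteq> D"
    using conn_in_comps[OF assms(1) _ assms(2) G] assms(3) by blast
  then have "D = C" using comps_disjoint[OF D(1) assms(4) _ G] assms(3) by blast
  then show ?thesis using D by simp
qed

text \<open>A connected set stays inside the component that it meets, so deleting vertices of
  \<open>C\<close> breaks up \<open>C\<close> alone. This is how the subtrees of a parent and of one
  of its children combine, both in contractions and in flips.\<close>

lemma comps_minus:
  assumes C: "C \<in> comps G" and Y: "Y \<subseteq> C" and G: "G \<subseteq> \<Union>H"
  shows "comps (G - Y) = comps (C - Y) \<union> (comps G - {C})"
proof -
  note CD = compsD[OF C G]
  have GY: "G - Y \<subseteq> \<Union>H" and CY: "C - Y \<subseteq> \<Union>H" using G CD by auto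
  show ?thesis
  proof (intro equalityI subsetI)
    fix E assume E: "E \<in> comps (G - Y)"
    note ED = compsD[OF E GY]
    obtain D where D: "D \<in> comps G" "E \<subseteq> D"
      using conn_in_comps[OF ED(3,1) _ G] ED(2) by blast
    show "E \<in> comps (C - Y) \<union> (comps G - {C})"
    proof (cases "D = C")
      case True
      then have "E \<subseteq> C - Y" "C - Y \<subseteq> G - Y" using D ED(2) CD(2) by auto
      then have "E \<in> comps (C - Y)"
        using ED comps_maximal[OF E GY] by (intro compsI[OF CY]) auto
      then show ?thesis by simp
    next
      case False
      then have "D \<subseteq> G - Y"
        using comps_disjoint[OF D(1) C _ G] Y compsD(2)[OF D(1) G] by blast
      then have "D = E"
        using comps_maximal[OF E GY D(2)] compsD(3)[OF D(1) G] by simp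
      then show ?thesis using D False by blast
    qed
  next
    fix E assume "E \<in> comps (C - Y) \<union> (comps G - {C})"
    then consider "E \<in> comps (C - Y)" | "E \<in> comps G" "E \<noteq> C" by blast
    then show "E \<in> comps (G - Y)"
    proof cases
      case 1
      note ED = compsD[OF 1 CY]
      have "D = E" if D: "E \<subseteq> D" "D \<subseteq> G - Y" "conn D" for D
      proof -
        have "D \<subseteq> C" using conn_subset_comp[OF D(3) _ _ C G] D ED(1,2) by blast
        then show ?thesis using comps_maximal[OF 1 CY D(1) _ D(3)] D(2) by blast
      qed
      moreover have "E \<subseteq> G - Y" using ED(2) CD(2) by blast
      ultimately show ?thesis using ED(1,3) by (intro compsI[OF GY])
    next
      case 2
      note ED = compsD[OF 2(1) G]
      have "E \<subseteq> G - Y" using comps_disjoint[OF 2(1) C _ G] Y 2(2) ED(2) by blast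
      moreover have "D = E" if "E \<subseteq> D" "D \<subseteq> G - Y" "conn D" for D
        using comps_maximal[OF 2(1) G that(1) _ that(3)] that(2) by blast
      ultimately show ?thesis using ED(1,3) by (intro compsI[OF GY])
    qed
  qed
qed

text \<open>Matches the two filters in rule \<open>root\<close> of \<open>flips\<close>: pieces
  inside \<open>C\<close> go below the lowered vertex, the others remain children of the new
  root.\<close>

lemma comps_subset_minus:
  assumes C: "C \<in> comps G" and Y: "Y \<subseteq> C" and G: "G \<subseteq> \<Union>H"
  shows "{E \<in> comps (G - Y). E \<subseteq> C} = comps (C - Y)"
    and "{E \<in> comps (G - Y). \<not> E \<subseteq> C} = comps G - {C}"
proof -
  have CY: "C - Y \<subseteq> \<Union>H" using compsD(4)[OF C G] by blast
  have 1: "E \<subseteq> C" if "E \<in> comps (C - Y)" for E using compsD(2)[OF that CY] by blast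
  have 2: "\<not> E \<subseteq> C" if "E \<in> comps G - {C}" for E
    using comps_disjoint[of E G C] compsD(1)[of E G] that C G by blast
  show "{E \<in> comps (G - Y). E \<subseteq> C} = comps (C - Y)"
    "{E \<in> comps (G - Y). \<not> E \<subseteq> C} = comps G - {C}"
    unfolding comps_minus[OF assms] using 1 2 by blast+
qed

section \<open>Constructs of restrictions of a hypergraph\<close>

text \<open>Indexing the immediate subtrees by components turns the replacement of one subtree into
  a function update.\<close>

definition branch :: "'a set \<Rightarrow> 'a set set \<Rightarrow> ('a set \<Rightarrow> 'a ltree) \<Rightarrow> 'a ltree" where
  "branch Y K F = Node Y (Abs_fset (F ` K))"

lemma fset_Abs_image: "finite K \<Longrightarrow> fset (Abs_fset (F ` K)) = F ` K"
  by (simp add: Abs_fset_inverse)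

lemma Node_eq_branch: "finite K \<Longrightarrow> fset ts = F ` K \<Longrightarrow> Node Y ts = branch Y K F"
  unfolding branch_def by (metis fset_inverse)

lemma branch_cong: "(\<And>C. C \<in> K \<Longrightarrow> F C = F' C) \<Longrightarrow> branch Y K F = branch Y K F'"
  unfolding branch_def by (metis image_cong)

definition con :: "'a set \<Rightarrow> 'a ltree \<Rightarrow> bool" where
  "con G T \<longleftrightarrow> G \<subseteq> \<Union>H \<and> construct (hg_restrict H G) T"

text \<open>The one-node tree is the case \<open>Y = G\<close>, where no component remains; so a
  single form covers both rules of \<open>construct\<close>.\<close>

lemma con_iff:
  "con G T \<longleftrightarrow> G \<subseteq> \<Union>H \<and> (\<exists>Y F. Y \<noteq> {} \<and> Y \<subseteq> G \<and> T = branch Y (comps (G - Y)) F \<and>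
     (\<forall>C\<in>comps (G - Y). con C (F C)))"
proof (intro iffI conjI)
  assume "con G T"
  then have G: "G \<subseteq> \<Union>H" and "construct (hg_restrict H G) T" unfolding con_def by auto
  from this(2) show "\<exists>Y F. Y \<noteq> {} \<and> Y \<subseteq> G \<and> T = branch Y (comps (G - Y)) F \<and>
     (\<forall>C\<in>comps (G - Y). con C (F C))"
  proof cases
    case single
    have "comps (G - G) = {}" using compsD(1,2)[of _ "{}"] by auto
    \<comment> \<open>With no component left, any function can serve as the family of
      subtrees.\<close>
    moreover have "Node G {||} = branch G {} undefined" by (rule Node_eq_branch) auto
    ultimately show ?thesis using single unfolding Union_restrict[OF G] by (metis empty_iff subset_refl)
  next
    case (graft Y f ts)
    have GY: "G - Y \<subseteq> \<Union>H" using G by blast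
    have K: "hg_components (hg_minus (hg_restrict H G) Y) = comps (G - Y)"
      unfolding minus_restrict[OF G] comps_def ..
    have "con C (f C)" if "C \<in> comps (G - Y)" for C
      using graft(4)[unfolded K, OF that] compsD[OF that GY] restrict_restrict[of C G]
      unfolding con_def by (metis Diff_subset subset_trans)
    moreover have "T = branch Y (comps (G - Y)) f"
      unfolding graft(1) using graft(5) K by (intro Node_eq_branch finite_comps GY) simp
    ultimately show ?thesis using graft(2,3) unfolding Union_restrict[OF G] by blast
  qed
next
  assume "con G T"
  then show "G \<subseteq> \<Union>H" unfolding con_def by blast
next
  assume "G \<subseteq> \<Union>H \<and> (\<exists>Y F. Y \<noteq> {} \<and> Y \<subseteq> G \<and> T = branch Y (comps (G - Y)) F \<and>
     (\<forall>C\<in>comps (G - Y). con C (F C)))"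
  then obtain Y F where G: "G \<subseteq> \<Union>H" and Y: "Y \<noteq> {}" "Y \<subseteq> G"
    and T: "T = branch Y (comps (G - Y)) F" and F: "\<forall>C\<in>comps (G - Y). con C (F C)" by blast
  have GY: "G - Y \<subseteq> \<Union>H" using G by blast
  show "con G T"
  proof (cases "Y = G")
    case True
    have "comps (G - G) = {}" using compsD(1,2)[of _ "{}"] by auto
    then have "T = Node (\<Union>(hg_restrict H G)) {||}"
      using T True unfolding Union_restrict[OF G] branch_def by (simp add: bot_fset_def)
    then show ?thesis unfolding con_def
      using construct.single[of "hg_restrict H G"] Y True G Union_restrict[OF G] by simp
  next
    case False
    have K: "hg_components (hg_minus (hg_restrict H G) Y) = comps (G - Y)"
      unfolding minus_restrict[OF G] comps_def ..
    have "construct (hg_restrict (hg_restrict H G) C) (F C)" if "C \<in> comps (G - Y)" for C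
    proof -
      have "C \<subseteq> G" using compsD(2)[OF that GY] by blast
      moreover have "construct (hg_restrict H C) (F C)"
        using bspec[OF F that] unfolding con_def by simp
      ultimately show ?thesis by (simp add: restrict_restrict)
    qed
    note F' = this
    have "construct (hg_restrict H G) T"
      unfolding T branch_def
    proof (rule construct.graft[of Y "hg_restrict H G" F, unfolded K Union_restrict[OF G]])
      show "fset (Abs_fset (F ` comps (G - Y))) = F ` comps (G - Y)"
        by (rule fset_Abs_image[OF finite_comps[OF GY]])
    qed (use Y False F' in auto)
    then show ?thesis unfolding con_def using G by blast
  qed
qed

lemma con_vertices: "con G T \<Longrightarrow> G \<subseteq> \<Union>H"
  unfolding con_def by blast

lemma con_branch:
  assumes "G \<subseteq> \<Union>H" "Y \<noteq> {}" "Y \<subseteq> G" "\<And>C. C \<in> comps (G - Y) \<Longrightarrow> con C (F C)"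
  shows "con G (branch Y (comps (G - Y)) F)"
  unfolding con_iff[of G] using assms by (intro conjI exI[of _ Y] exI[of _ F]) auto

lemma comp_psubset:
  assumes "C \<in> comps (G - Y)" "G \<subseteq> \<Union>H" "Y \<noteq> {}" "Y \<subseteq> G"
  shows "C \<subset> G"
proof -
  have "G - Y \<subseteq> \<Union>H" using assms by blast
  then show ?thesis using compsD(2)[OF assms(1)] assms by blast
qed

lemma con_induct [consumes 1, case_names branch]:
  assumes "con G T"
    and step: "\<And>G Y F. \<lbrakk>G \<subseteq> \<Union>H; Y \<noteq> {}; Y \<subseteq> G; \<And>C. C \<in> comps (G - Y) \<Longrightarrow> con C (F C);
      \<And>C. C \<in> comps (G - Y) \<Longrightarrow> P C (F C)\<rbrakk> \<Longrightarrow> P G (branch Y (comps (G - Y)) F)"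
  shows "P G T"
proof -
  have "finite G" using finite_subset_vertices con_vertices[OF assms(1)] .
  then show ?thesis using assms(1)
  proof (induction G arbitrary: T rule: finite_psubset_induct)
    case (psubset G)
    obtain Y F where G: "G \<subseteq> \<Union>H" and Y: "Y \<noteq> {}" "Y \<subseteq> G"
      and T: "T = branch Y (comps (G - Y)) F" and F: "\<forall>C\<in>comps (G - Y). con C (F C)"
      using psubset.prems unfolding con_iff[of G] by blast
    have "P C (F C)" if "C \<in> comps (G - Y)" for C
      using psubset.IH[OF comp_psubset[OF that G Y]] F that by blast
    then show ?case unfolding T using step[OF G Y] F by blast
  qed
qed

lemma support_branch:
  "finite K \<Longrightarrow> support (branch Y K F) = Y \<union> (\<Union>C\<in>K. support (F C))"
  unfolding branch_def support_Node by (simp add: fset_Abs_image)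

lemma con_support: "con G T \<Longrightarrow> support T = G"
proof (induction rule: con_induct)
  case (branch G Y F)
  have GY: "G - Y \<subseteq> \<Union>H" using branch(1) by blast
  have "support (branch Y (comps (G - Y)) F) = Y \<union> (\<Union>C\<in>comps (G - Y). C)"
    using branch(5) by (simp add: support_branch finite_comps[OF GY])
  then show ?case using Union_comps[OF GY] branch(3) by auto
qed

section \<open>Choice rules and the constructs that they determine\<close>

lemma exact_branch:
  assumes "con G (branch Y (comps (G - Y)) F)"
  shows "exact c (branch Y (comps (G - Y)) F) \<longleftrightarrow> Y = c G \<and> (\<forall>C\<in>comps (G - Y). exact c (F C))"
proof -
  have "G - Y \<subseteq> \<Union>H" using con_vertices[OF assms] by blast
  then show ?thesis
    using con_support[OF assms] unfolding branch_def exact_Node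
    by (simp add: fset_Abs_image finite_comps)
qed

lemma compat_branch:
  assumes "con G (branch Y (comps (G - Y)) F)"
  shows "compat c (branch Y (comps (G - Y)) F) \<longleftrightarrow> Y \<subseteq> c G \<and> (\<forall>C\<in>comps (G - Y). compat c (F C))"
proof -
  have "G - Y \<subseteq> \<Union>H" using con_vertices[OF assms] by blast
  then show ?thesis
    using con_support[OF assms] unfolding branch_def compat_Node
    by (simp add: fset_Abs_image finite_comps)
qed

lemma con_separated: "con G T \<Longrightarrow> separated T"
proof (induction rule: con_induct)
  case (branch G Y F)
  have GY: "G - Y \<subseteq> \<Union>H" using branch(1) by blast
  note K = fset_Abs_image[OF finite_comps[OF GY]]
  have s: "support (F C) = C" if "C \<in> comps (G - Y)" for C
    using con_support[OF branch(4)[OF that]] .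
  show ?case unfolding branch_def
  proof (rule separated.intros)
    fix t assume "t |\<in>| Abs_fset (F ` comps (G - Y))"
    then obtain C where C: "C \<in> comps (G - Y)" "t = F C" unfolding K by blast
    then show "separated t \<and> Y \<inter> support t = {}"
      using branch(5)[OF C(1)] s[OF C(1)] compsD(2)[OF C(1) GY] by blast
    fix u assume "u |\<in>| Abs_fset (F ` comps (G - Y))" and tu: "t \<noteq> u"
    then obtain D where D: "D \<in> comps (G - Y)" "u = F D" unfolding K by blast
    then show "support t \<inter> support u = {}"
      using s C tu comps_disjoint[OF C(1) D(1) _ GY] by metis
  qed (rule branch(2))
qed

text \<open>Rankings of the subtrees can be glued because components are disjoint; the root label is
  then given a rank above all others.\<close>

lemma con_exact_exists: "con G T \<Longrightarrow> \<exists>p. exact (top_by p) T"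
proof (induction rule: con_induct)
  case (branch G Y F)
  have GY: "G - Y \<subseteq> \<Union>H" using branch(1) by blast
  have fin: "finite G" using finite_subset_vertices[OF branch(1)] .
  obtain P where P: "\<And>C. C \<in> comps (G - Y) \<Longrightarrow> exact (top_by (P C)) (F C)"
    using branch(5) by metis
  \<comment> \<open>For \<open>v\<close> in \<open>Y\<close> the description denotes no particular
    component, but \<open>p\<close> overrides the value there. The maximum over all of
    \<open>G\<close> bounds the rank of every other vertex, and \<open>Suc\<close> excludes ties
    with the root.\<close>
  define q where "q v = P (THE C. C \<in> comps (G - Y) \<and> v \<in> C) v" for v
  define p where "p v = (if v \<in> Y then Suc (Max (q ` G)) else q v)" for v
  have p: "p v = P C v" if "C \<in> comps (G - Y)" "v \<in> C" for C v
  proof -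
    have "(THE C. C \<in> comps (G - Y) \<and> v \<in> C) = C"
      using that comps_disjoint[OF _ that(1) _ GY] by (intro the_equality) auto
    moreover have "v \<notin> Y" using that compsD(2)[OF that(1) GY] by blast
    ultimately show ?thesis unfolding p_def q_def by simp
  qed
  have "exact (top_by p) (F C)" if C: "C \<in> comps (G - Y)" for C
  proof -
    have "top_by p D = top_by (P C) D" if "D \<subseteq> support (F C)" for D
      using that p[OF C] con_support[OF branch(4)[OF C]] unfolding top_by_def
      by (smt (verit) Collect_cong subset_iff)
    then show ?thesis using P[OF C] exact_cong by blast
  qed
  moreover have "Y = top_by p G"
  proof -
    have less: "p w < Suc (Max (q ` G))" if "w \<in> G - Y" for w
      using that fin unfolding p_def by (simp add: le_imp_less_Suc)
    obtain y where y: "y \<in> Y" using branch(2) by blast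
    have Y: "p v = Suc (Max (q ` G))" if "v \<in> Y" for v using that by (simp add: p_def)
    have "v \<in> top_by p G" if "v \<in> Y" for v
    proof -
      have "p w \<le> p v" if "w \<in> G" for w
        using less[of w] Y[of w] Y[OF \<open>v \<in> Y\<close>] that by (cases "w \<in> Y") auto
      then show ?thesis using that branch(3) unfolding top_by_def by blast
    qed
    moreover have "v \<in> Y" if "v \<in> top_by p G" for v
    proof (rule ccontr)
      assume "v \<notin> Y"
      then have "p v < p y" using less that Y[OF y] unfolding top_by_def by simp
      then show False using that y branch(3) unfolding top_by_def by (simp add: subset_iff leD)
    qed
    ultimately show ?thesis by blast
  qed
  ultimately show ?case
    using exact_branch[OF con_branch[OF branch(1-4)], of "top_by p"] by blast
qed

text \<open>The root label \<open>c G\<close> fixes the components, and with them, recursively, the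
  subtrees.\<close>

lemma exact_unique:
  assumes "con G T" "con G T'" "exact c T" "exact c T'"
  shows "T = T'"
  using assms
proof (induction arbitrary: T' rule: con_induct)
  case (branch G Y F)
  have con: "con G (branch Y (comps (G - Y)) F)" by (rule con_branch[OF branch.hyps])
  have Y: "Y = c G" and F: "\<And>C. C \<in> comps (G - Y) \<Longrightarrow> exact c (F C)"
    using branch.prems(2) unfolding exact_branch[OF con] by auto
  obtain Y' F' where T': "T' = branch Y' (comps (G - Y')) F'"
    and F': "\<forall>C\<in>comps (G - Y'). con C (F' C)"
    using branch.prems(1) unfolding con_iff[of G] by blast
  have e: "Y' = c G" "\<forall>C\<in>comps (G - Y'). exact c (F' C)"
    using branch.prems(3) unfolding T' exact_branch[OF branch.prems(1)[unfolded T']] by auto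
  then have "Y' = Y" using Y by simp
  then show ?case unfolding T' using branch.IH F F' e by (auto intro!: branch_cong)
qed

text \<open>What a recursion from the root downwards asks of a rule; coherent rules and the
  \<open>greedy\<close> rules derived from them both satisfy it.\<close>

definition proper :: "('a set \<Rightarrow> 'a set) \<Rightarrow> bool" where
  "proper c \<longleftrightarrow> (\<forall>C. C \<subseteq> \<Union>H \<longrightarrow> C \<noteq> {} \<longrightarrow> c C \<noteq> {} \<and> c C \<subseteq> C)"

lemma coherent_proper: "coherent c \<Longrightarrow> proper c"
  unfolding proper_def using coherentD(1,2)[of c] finite_subset_vertices by simp

definition build :: "('a set \<Rightarrow> 'a set) \<Rightarrow> 'a set \<Rightarrow> 'a ltree" where
  "build c G = (THE T. con G T \<and> exact c T)"

lemma exact_exists: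
  assumes c: "proper c" and G: "G \<subseteq> \<Union>H" "G \<noteq> {}"
  shows "\<exists>T. con G T \<and> exact c T"
proof -
  have "finite G" using finite_subset_vertices G(1) .
  then show ?thesis using G
  proof (induction rule: finite_psubset_induct)
    case (psubset G)
    have cG: "c G \<noteq> {}" "c G \<subseteq> G" using c psubset.prems unfolding proper_def by auto
    have GY: "G - c G \<subseteq> \<Union>H" using psubset.prems by blast
    have "\<exists>T. con C T \<and> exact c T" if "C \<in> comps (G - c G)" for C
      using psubset.IH[OF comp_psubset[OF that psubset.prems(1) cG]] compsD[OF that GY] by blast
    then obtain F where F: "\<And>C. C \<in> comps (G - c G) \<Longrightarrow> con C (F C) \<and> exact c (F C)" by metis
    then have "con G (branch (c G) (comps (G - c G)) F)"
      by (intro con_branch psubset.prems cG) auto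
    then show ?case using exact_branch F by blast
  qed
qed

lemma build:
  assumes "proper c" "G \<subseteq> \<Union>H" "G \<noteq> {}"
  shows "con G (build c G)" "exact c (build c G)"
proof -
  have "\<exists>!T. con G T \<and> exact c T" using exact_exists[OF assms] exact_unique by blast
  then have "con G (build c G) \<and> exact c (build c G)" unfolding build_def by (rule theI')
  then show "con G (build c G)" "exact c (build c G)" by auto
qed

lemma build_eqI: "con G T \<Longrightarrow> exact c T \<Longrightarrow> build c G = T"
  unfolding build_def by (rule the_equality) (auto intro: exact_unique)

lemma build_branch:
  assumes c: "proper c" and G: "G \<subseteq> \<Union>H" "G \<noteq> {}"
  shows "build c G = branch (c G) (comps (G - c G)) (build c)"
proof (rule build_eqI)
  have cG: "c G \<noteq> {}" "c G \<subseteq> G" using c G unfolding proper_def by auto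
  have GY: "G - c G \<subseteq> \<Union>H" using G by blast
  have b: "con C (build c C) \<and> exact c (build c C)" if "C \<in> comps (G - c G)" for C
    using build[OF c] compsD[OF that GY] by blast
  then show con: "con G (branch (c G) (comps (G - c G)) (build c))"
    by (intro con_branch G cG) auto
  show "exact c (branch (c G) (comps (G - c G)) (build c))"
    using b unfolding exact_branch[OF con] by blast
qed

end

section \<open>Labels in subtrees, and selection of single vertices\<close>

lemma node_subtree: "X \<in> nodes T \<Longrightarrow> \<exists>ts. Node X ts \<in> subtrees T"
proof (induction T)
  case (Node Y ts)
  show ?case
  proof (cases "X = Y")
    case True
    then show ?thesis using subtrees_self by blast
  next
    case False
    then obtain t where "t |\<in>| ts" "X \<in> nodes t" using Node.prems by auto
    then show ?thesis using Node.IH[of t] unfolding subtrees_Node by blast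
  qed
qed

lemma contracts_merged: "contracts X Y S T \<Longrightarrow> \<exists>ts. Node (X \<union> Y) ts \<in> subtrees T"
proof (induction rule: contracts.induct)
  case (root us ts)
  then show ?case using subtrees_self by blast
next
  case (subtree t ts t' Z)
  then show ?case by auto
qed

lemma contracts_labels:
  "contracts X Y S T \<Longrightarrow> separated S \<Longrightarrow> X \<noteq> {} \<and> Y \<noteq> {} \<and> X \<inter> Y = {}"
proof (induction rule: contracts.induct)
  case (root us ts)
  note X = separatedD[OF root(2)]
  have "Y \<subseteq> support (Node Y us)" by (simp add: support_Node)
  then show ?case using X(1) X(3)[OF root(1)] separatedD(1)[OF X(2)[OF root(1)]] by blast
next
  case (subtree t ts t' Z)
  then show ?case using separatedD(2)[OF subtree.prems subtree.hyps(1)] by blast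
qed

text \<open>The common form of \<open>Min\<close> with \<open><\<close> and \<open>Max\<close> with
  \<open>>\<close>, so that one argument yields both extremes. The last clause is independence of
  irrelevant alternatives: a selected element remains selected in a smaller set that contains
  it.\<close>

definition selection :: "('a \<Rightarrow> 'a \<Rightarrow> bool) \<Rightarrow> ('a set \<Rightarrow> 'a) \<Rightarrow> bool" where
  "selection r sel \<longleftrightarrow> (\<forall>Q. finite Q \<longrightarrow> Q \<noteq> {} \<longrightarrow> sel Q \<in> Q) \<and>
     (\<forall>Q q. finite Q \<longrightarrow> q \<in> Q \<longrightarrow> q \<noteq> sel Q \<longrightarrow> r (sel Q) q) \<and>
     (\<forall>Q Q'. finite Q \<longrightarrow> Q' \<subseteq> Q \<longrightarrow> sel Q \<in> Q' \<longrightarrow> sel Q' = sel Q)"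

lemma selectionI:
  assumes "\<And>Q. finite Q \<Longrightarrow> Q \<noteq> {} \<Longrightarrow> sel Q \<in> Q"
    "\<And>Q q. finite Q \<Longrightarrow> q \<in> Q \<Longrightarrow> q \<noteq> sel Q \<Longrightarrow> r (sel Q) q"
    "\<And>Q Q'. finite Q \<Longrightarrow> Q' \<subseteq> Q \<Longrightarrow> sel Q \<in> Q' \<Longrightarrow> sel Q' = sel Q"
  shows "selection r sel"
  unfolding selection_def
proof (intro conjI allI impI)
  show "sel Q \<in> Q" if "finite Q" "Q \<noteq> {}" for Q using assms(1)[OF that] .
  show "r (sel Q) q" if "finite Q" "q \<in> Q" "q \<noteq> sel Q" for Q q using assms(2)[OF that] .
  show "sel Q' = sel Q" if "finite Q" "Q' \<subseteq> Q" "sel Q \<in> Q'" for Q Q' using assms(3)[OF that] .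
qed

lemma selectionD:
  assumes "selection r sel" "finite Q"
  shows "Q \<noteq> {} \<Longrightarrow> sel Q \<in> Q" "q \<in> Q \<Longrightarrow> q \<noteq> sel Q \<Longrightarrow> r (sel Q) q"
    "Q' \<subseteq> Q \<Longrightarrow> sel Q \<in> Q' \<Longrightarrow> sel Q' = sel Q"
proof -
  note d = assms(1)[unfolded selection_def, THEN conjunct1, rule_format]
    assms(1)[unfolded selection_def, THEN conjunct2, THEN conjunct1, rule_format]
    assms(1)[unfolded selection_def, THEN conjunct2, THEN conjunct2, rule_format]
  show "Q \<noteq> {} \<Longrightarrow> sel Q \<in> Q" by (rule d(1)[OF assms(2)])
  show "q \<in> Q \<Longrightarrow> q \<noteq> sel Q \<Longrightarrow> r (sel Q) q" by (rule d(2)[OF assms(2)])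
  show "Q' \<subseteq> Q \<Longrightarrow> sel Q \<in> Q' \<Longrightarrow> sel Q' = sel Q" by (rule d(3)[OF assms(2)])
qed

definition greedy :: "('a set \<Rightarrow> 'a) \<Rightarrow> ('a set \<Rightarrow> 'a set) \<Rightarrow> 'a set \<Rightarrow> 'a set" where
  "greedy sel c C = {sel (c C)}"

lemma (in finite_hypergraph) greedy_subset:
  assumes "selection r sel" "coherent c" "C \<subseteq> \<Union>H" "C \<noteq> {}"
  shows "greedy sel c C \<subseteq> c C"
proof -
  have "finite C" using finite_subset_vertices assms(3) .
  then have "finite (c C)" "c C \<noteq> {}"
    using coherentD(1,2)[OF assms(2), of C] assms(4) finite_subset by blast+
  then show ?thesis using selectionD(1)[OF assms(1)] unfolding greedy_def by simp
qed

lemma (in finite_hypergraph) greedy_proper: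
  assumes "selection r sel" "coherent c"
  shows "proper (greedy sel c)"
  using greedy_subset[OF assms] coherentD(1)[OF assms(2)] unfolding proper_def
  by (auto simp: greedy_def)

context finite_hypergraph
begin

section \<open>Faces and contractions of constructs\<close>

lemma con_nonempty: "con G T \<Longrightarrow> G \<noteq> {}"
  unfolding con_iff[of G] by blast

lemma subtrees_branch:
  "finite K \<Longrightarrow> subtrees (branch Y K F) = insert (branch Y K F) (\<Union>C\<in>K. subtrees (F C))"
  unfolding branch_def subtrees_Node by (simp add: fset_Abs_image)

lemma con_subtree: "con G T \<Longrightarrow> t \<in> subtrees T \<Longrightarrow> \<exists>D. con D t"
proof (induction rule: con_induct)
  case (branch G Y F)
  have "G - Y \<subseteq> \<Union>H" using branch(1) by blast
  then have "finite (comps (G - Y))" by (rule finite_comps)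
  then have "t = branch Y (comps (G - Y)) F \<or> (\<exists>C\<in>comps (G - Y). t \<in> subtrees (F C))"
    using branch.prems by (simp add: subtrees_branch)
  then show ?case
  proof
    assume "t = branch Y (comps (G - Y)) F"
    then show ?thesis using con_branch[OF branch.hyps] by blast
  next
    assume "\<exists>C\<in>comps (G - Y). t \<in> subtrees (F C)"
    then show ?thesis using branch.IH by blast
  qed
qed

lemma con_subtree_support:
  assumes "con G T" "t \<in> subtrees T"
  shows "support t \<subseteq> \<Union>H" "support t \<noteq> {}"
proof -
  obtain D where "con D t" using con_subtree[OF assms] by blast
  then show "support t \<subseteq> \<Union>H" "support t \<noteq> {}"
    using con_support con_vertices con_nonempty by auto
qed

lemma exact_compat:
  assumes "con G T" "exact q T" "\<And>D. D \<subseteq> \<Union>H \<Longrightarrow> D \<noteq> {} \<Longrightarrow> q D \<subseteq> c D"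
  shows "compat c T"
  unfolding compat_def
proof (intro allI impI)
  fix Y ts assume t: "Node Y ts \<in> subtrees T"
  then have "Y = q (support (Node Y ts))" using assms(2) unfolding exact_def by blast
  then show "Y \<subseteq> c (support (Node Y ts))"
    using assms(3)[OF con_subtree_support[OF assms(1) t]] by simp
qed

lemma image_Diff_single:
  assumes "a \<in> A" "\<And>b. b \<in> A \<Longrightarrow> b \<noteq> a \<Longrightarrow> f b \<noteq> f a"
  shows "f ` A - {f a} = f ` (A - {a})"
proof (intro equalityI subsetI)
  fix z assume "z \<in> f ` (A - {a})"
  then obtain b where "b \<in> A" "b \<noteq> a" "z = f b" by blast
  then show "z \<in> f ` A - {f a}" using assms(2)[of b] by simp
qed auto

text \<open>Subtrees on distinct components have distinct supports, so deleting \<open>F C\<close>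
  from the set of subtrees deletes no other one.\<close>

lemma branch_update:
  assumes K: "finite K" "C \<in> K" and s: "\<And>D. D \<in> K \<Longrightarrow> support (F D) = D"
  shows "F C |\<in>| Abs_fset (F ` K)"
    and "Node Y (finsert t (Abs_fset (F ` K) |-| {|F C|})) = branch Y K (F(C := t))"
proof -
  show "F C |\<in>| Abs_fset (F ` K)" using K(2) unfolding fset_Abs_image[OF K(1)] by (rule imageI)
  have "F D \<noteq> F C" if "D \<in> K" "D \<noteq> C" for D
    using that s[OF that(1)] s[OF K(2)] by (metis (full_types))
  then have "F ` K - {F C} = F ` (K - {C})" by (rule image_Diff_single[OF K(2)])
  moreover have "(F(C := t)) ` K = insert t (F ` (K - {C}))" using K(2) by auto
  ultimately have "insert t (F ` K - {F C}) = (F(C := t)) ` K" by simp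
  then show "Node Y (finsert t (Abs_fset (F ` K) |-| {|F C|})) = branch Y K (F(C := t))"
    by (intro Node_eq_branch K) (simp add: fset_Abs_image[OF K(1)])
qed

text \<open>Transfers paths in the subtrees to a path of the whole tree, one component after
  another. It is used for facets and for flips; \<open>P\<close> is the invariant of a subtree that
  keeps the single steps applicable.\<close>

lemma branch_lift:
  assumes K: "finite K"
    and step: "\<And>F C t. \<lbrakk>\<And>D. D \<in> K \<Longrightarrow> P D (F D); C \<in> K; R C (F C) t\<rbrakk>
      \<Longrightarrow> Q (branch Y K F) (branch Y K (F(C := t)))"
    and inv: "\<And>C t t'. P C t \<Longrightarrow> R C t t' \<Longrightarrow> P C t'"
    and P: "\<And>C. C \<in> K \<Longrightarrow> P C (F C)"
    and R: "\<And>C. C \<in> K \<Longrightarrow> (R C)\<^sup>*\<^sup>* (F C) (F' C)"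
  shows "Q\<^sup>*\<^sup>* (branch Y K F) (branch Y K F')"
proof -
  have one: "Q\<^sup>*\<^sup>* (branch Y K F) (branch Y K (F(C := t))) \<and> P C t"
    if PF: "\<And>D. D \<in> K \<Longrightarrow> P D (F D)" and C: "C \<in> K" and "(R C)\<^sup>*\<^sup>* (F C) t" for F C t
    using that(3)
  proof (induction rule: rtranclp_induct)
    case base
    then show ?case using PF[OF C] by simp
  next
    case (step t u)
    have "Q (branch Y K (F(C := t))) (branch Y K ((F(C := t))(C := u)))"
      by (rule assms(2)) (use PF C step in auto)
    then have "Q (branch Y K (F(C := t))) (branch Y K (F(C := u)))" by simp
    then show ?case using step inv[of C t u] by (meson rtranclp.rtrancl_into_rtrancl)
  qed
  \<comment> \<open>\<open>J\<close> collects the components whose subtrees have already been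
    transformed.\<close>
  have "Q\<^sup>*\<^sup>* (branch Y K F) (branch Y K (\<lambda>C. if C \<in> J then F' C else F C)) \<and>
      (\<forall>C\<in>J. P C (F' C))" if "J \<subseteq> K" for J
    using finite_subset[OF that K] that
  proof (induction J rule: finite_induct)
    case empty
    then show ?case by simp
  next
    case (insert C J)
    let ?F = "\<lambda>C. if C \<in> J then F' C else F C"
    have IH: "Q\<^sup>*\<^sup>* (branch Y K F) (branch Y K ?F)" "\<forall>C\<in>J. P C (F' C)" using insert by auto
    have "P D (?F D)" if "D \<in> K" for D using that IH P by simp
    then have "Q\<^sup>*\<^sup>* (branch Y K ?F) (branch Y K (?F(C := F' C))) \<and> P C (F' C)"
      using insert R[of C] by (intro one) auto
    moreover have "?F(C := F' C) = (\<lambda>D. if D \<in> insert C J then F' D else F D)" by auto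
    ultimately show ?case using IH rtranclp_trans[of Q] by auto
  qed
  from this[of K] have "Q\<^sup>*\<^sup>* (branch Y K F) (branch Y K (\<lambda>C. if C \<in> K then F' C else F C))" by simp
  then show ?thesis using branch_cong[of K "\<lambda>C. if C \<in> K then F' C else F C" F' Y] by simp
qed

lemma face_branch:
  assumes K: "finite K" and s: "\<And>C. C \<in> K \<Longrightarrow> support (F C) = C"
    and f: "\<And>C. C \<in> K \<Longrightarrow> face (F C) (F' C)"
  shows "face (branch Y K F) (branch Y K F')"
  unfolding face_def
proof (rule branch_lift[OF K, where P = "\<lambda>C t. support t = C" and R = "\<lambda>_. facet"])
  fix F C t assume s: "\<And>D. D \<in> K \<Longrightarrow> support (F D) = D" and C: "C \<in> K" and "facet (F C) t"
  from this(3) obtain X Z where "contracts X Z (F C) t" unfolding facet_def by blast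
  then have "contracts X Z (branch Y K F) (branch Y K (F(C := t)))"
    using contracts.subtree[OF branch_update(1), OF K C s, of X Z t Y]
      branch_update(2)[OF K C s, of Y t] unfolding branch_def by simp
  then show "facet (branch Y K F) (branch Y K (F(C := t)))" unfolding facet_def by blast
next
  fix C t t' assume "support t = C" "facet t t'"
  then show "support t' = C" using contracts_support unfolding facet_def by blast
next
  fix C assume "C \<in> K"
  then show "support (F C) = C" "facet\<^sup>*\<^sup>* (F C) (F' C)" using s f unfolding face_def by auto
qed

lemma build_con:
  assumes "coherent c" "D \<subseteq> \<Union>H" "D \<noteq> {}"
  shows "con D (build c D)" "support (build c D) = D"
  using build(1)[OF coherent_proper assms(2,3)] assms(1) con_support by auto

text \<open>As long as the root lacks some vertex of \<open>c G\<close>, that vertex lies in a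
  component \<open>C\<close> whose subtree has, by coherence, the root label
  \<open>c G \<inter> C\<close>. Contracting this edge enlarges \<open>Y\<close> inside
  \<open>c G\<close> and leaves the other subtrees as \<open>c\<close> builds them, so the number of
  missing vertices decreases.\<close>

lemma face_merge:
  assumes c: "coherent c" and G: "G \<subseteq> \<Union>H" and Y: "Y \<noteq> {}" "Y \<subseteq> c G"
  shows "face (branch Y (comps (G - Y)) (build c)) (build c G)"
  using Y
proof (induction "card (c G - Y)" arbitrary: Y rule: less_induct)
  case less
  have cG: "c G \<subseteq> G" using coherentD(1)[OF c] .
  have Gne: "G \<noteq> {}" using less.prems cG by blast
  have GY: "G - Y \<subseteq> \<Union>H" using G by blast
  note pr = coherent_proper[OF c]
  show ?case
  proof (cases "Y = c G")
    case True
    then show ?thesis using build_branch[OF pr G Gne] by (simp add: face_def)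
  next
    case False
    then obtain z where z: "z \<in> c G" "z \<notin> Y" using less.prems by blast
    then have "z \<in> G - Y" using cG by blast
    then obtain C where C: "C \<in> comps (G - Y)" "z \<in> C" by (rule comps_cover[OF _ GY])
    note CD = compsD[OF C(1) GY]
    let ?Z = "c C" and ?K = "comps (G - Y)"
    have Z: "?Z = c G \<inter> C" using coherentD(3)[OF c, of C G] CD(2) z(1) C(2) by blast
    have CZ: "C - ?Z \<subseteq> \<Union>H" and ZC: "?Z \<subseteq> C" using CD Z by auto
    have bC: "build c C = Node ?Z (Abs_fset (build c ` comps (C - ?Z)))"
      using build_branch[OF pr CD(4,1)] unfolding branch_def .
    have fin: "finite ?K" by (rule finite_comps[OF GY])
    have s: "support (build c D) = D" if "D \<in> ?K" for D
      using build_con(2)[OF c] compsD[OF that GY] by blast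
    have "build c D \<noteq> build c C" if "D \<in> ?K" "D \<noteq> C" for D
      using s[OF that(1)] s[OF C(1)] that(2) by metis
    then have minus: "build c ` ?K - {build c C} = build c ` (?K - {C})"
      by (rule image_Diff_single[OF C(1)])
    let ?ts = "Abs_fset (build c ` ?K)" and ?us = "Abs_fset (build c ` comps (C - ?Z))"
    have "contracts Y ?Z (Node Y ?ts) (Node (Y \<union> ?Z) (?us |\<union>| (?ts |-| {|Node ?Z ?us|})))"
    proof (rule contracts.root)
      show "Node ?Z ?us |\<in>| ?ts"
        unfolding bC[symmetric] fset_Abs_image[OF fin] using C(1) by (rule imageI)
    qed
    moreover have "Node (Y \<union> ?Z) (?us |\<union>| (?ts |-| {|Node ?Z ?us|}))
        = branch (Y \<union> ?Z) (comps (G - (Y \<union> ?Z))) (build c)"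
    proof (rule Node_eq_branch)
      have K: "comps (G - (Y \<union> ?Z)) = comps (C - ?Z) \<union> (?K - {C})"
        using comps_minus[OF C(1) ZC GY] by (simp add: Diff_Diff_Int Diff_eq Int_assoc)
      have "fset (?us |\<union>| (?ts |-| {|Node ?Z ?us|}))
          = build c ` comps (C - ?Z) \<union> (build c ` ?K - {build c C})"
        unfolding bC[symmetric] by (simp add: fset_Abs_image fin finite_comps[OF CZ])
      then show "fset (?us |\<union>| (?ts |-| {|Node ?Z ?us|})) = build c ` comps (G - (Y \<union> ?Z))"
        unfolding minus K image_Un .
      show "finite (comps (G - (Y \<union> ?Z)))" using G by (intro finite_comps) blast
    qed
    ultimately have "facet (branch Y ?K (build c)) (branch (Y \<union> ?Z) (comps (G - (Y \<union> ?Z))) (build c))"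
      unfolding facet_def branch_def by auto
    moreover have "face (branch (Y \<union> ?Z) (comps (G - (Y \<union> ?Z))) (build c)) (build c G)"
    proof (rule less.hyps)
      have "finite (c G)" using cG finite_subset_vertices[OF G] finite_subset by blast
      moreover have "c G - (Y \<union> ?Z) \<subset> c G - Y" using z C(2) Z by blast
      ultimately show "card (c G - (Y \<union> ?Z)) < card (c G - Y)" by (intro psubset_card_mono) auto
      show "Y \<union> ?Z \<noteq> {}" "Y \<union> ?Z \<subseteq> c G" using less.prems Z by auto
    qed
    ultimately show ?thesis unfolding face_def by (meson converse_rtranclp_into_rtranclp)
  qed
qed

text \<open>The converse of \<open>face_compat\<close>: contract inside the subtrees, by induction,
  until they are those built from \<open>c\<close>, and then at the root by
  \<open>face_merge\<close>.\<close>

lemma compat_face: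
  assumes c: "coherent c" and "con G T" "compat c T"
  shows "face T (build c G)"
  using assms(2,3)
proof (induction rule: con_induct)
  case (branch G Y F)
  have con: "con G (branch Y (comps (G - Y)) F)" by (rule con_branch[OF branch.hyps])
  have GY: "G - Y \<subseteq> \<Union>H" using branch(1) by blast
  have cY: "Y \<subseteq> c G" and cF: "\<And>C. C \<in> comps (G - Y) \<Longrightarrow> compat c (F C)"
    using branch.prems unfolding compat_branch[OF con] by auto
  have "face (branch Y (comps (G - Y)) F) (branch Y (comps (G - Y)) (build c))"
    using branch.IH cF con_support[OF branch.hyps(4)] by (intro face_branch finite_comps GY) auto
  then show ?case
    using face_merge[OF c branch(1,2) cY] unfolding face_def by (rule rtranclp_trans)
qed

section \<open>Flips of constructions\<close>

definition cns :: "'a set \<Rightarrow> 'a ltree \<Rightarrow> bool" where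
  "cns G T \<longleftrightarrow> con G T \<and> (\<forall>X\<in>nodes T. is_singleton X)"

lemma nodes_branch: "finite K \<Longrightarrow> nodes (branch Y K F) = insert Y (\<Union>C\<in>K. nodes (F C))"
  unfolding branch_def by (simp add: fset_Abs_image)

lemma cns_branch:
  assumes G: "G \<subseteq> \<Union>H" "y \<in> G" and F: "\<And>C. C \<in> comps (G - {y}) \<Longrightarrow> cns C (F C)"
  shows "cns G (branch {y} (comps (G - {y})) F)"
proof -
  have "G - {y} \<subseteq> \<Union>H" using G by blast
  moreover have "con G (branch {y} (comps (G - {y})) F)"
    using G F by (intro con_branch) (auto simp: cns_def)
  ultimately show ?thesis using F unfolding cns_def by (auto simp: nodes_branch finite_comps)
qed

lemma cns_cases:
  assumes "cns G T"
  obtains y F where "y \<in> G" "T = branch {y} (comps (G - {y})) F"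
    "\<And>C. C \<in> comps (G - {y}) \<Longrightarrow> cns C (F C)"
proof -
  have con: "con G T" and n: "\<forall>X\<in>nodes T. is_singleton X" using assms unfolding cns_def by auto
  then obtain Y F where G: "G \<subseteq> \<Union>H" and Y: "Y \<subseteq> G"
    and T: "T = branch Y (comps (G - Y)) F" and F: "\<forall>C\<in>comps (G - Y). con C (F C)"
    unfolding con_iff[of G] by blast
  have fin: "finite (comps (G - Y))" using G by (intro finite_comps) blast
  have "is_singleton Y" using n unfolding T nodes_branch[OF fin] by simp
  then obtain y where y: "Y = {y}" by (auto simp: is_singleton_def)
  have "cns C (F C)" if "C \<in> comps (G - Y)" for C
    using F n that unfolding T nodes_branch[OF fin] cns_def by auto
  then show ?thesis using that Y T unfolding y by blast
qed

lemma cns_con: "cns G T \<Longrightarrow> con G T"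
  unfolding cns_def by blast

lemma cns_build:
  assumes "selection r sel" "coherent c" "G \<subseteq> \<Union>H" "G \<noteq> {}"
  shows "cns G (build (greedy sel c) G)"
proof -
  note b = build[OF greedy_proper[OF assms(1,2)] assms(3,4)]
  have "is_singleton X" if X: "X \<in> nodes (build (greedy sel c) G)" for X
  proof -
    obtain ts where "Node X ts \<in> subtrees (build (greedy sel c) G)" using node_subtree[OF X] by blast
    then have "X = greedy sel c (support (Node X ts))" using b(2) unfolding exact_def by blast
    then show ?thesis unfolding greedy_def is_singleton_def by blast
  qed
  then show ?thesis using b(1) unfolding cns_def by blast
qed

lemma compat_build_greedy:
  assumes "selection r sel" "coherent c" "G \<subseteq> \<Union>H" "G \<noteq> {}"
  shows "compat c (build (greedy sel c) G)"
  using build[OF greedy_proper[OF assms(1,2)] assms(3,4)] greedy_subset[OF assms(1,2)]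
  by (rule exact_compat)

lemma flips_branch:
  assumes K: "finite K" "C \<in> K" and s: "\<And>D. D \<in> K \<Longrightarrow> support (F D) = D"
    and f: "flips H x y (F C) t"
  shows "flips H x y (branch Y K F) (branch Y K (F(C := t)))"
  using flips.subtree[OF branch_update(1)[OF K s] f, of Y] branch_update(2)[OF K s, of Y t]
  unfolding branch_def by simp

text \<open>Both trees are assembled from one family \<open>F\<close>. The hypotheses are symmetric
  under exchanging \<open>x\<close> with \<open>y\<close> and \<open>C\<close> with
  \<open>D\<close>, so the same lemma also yields the reverse flip.\<close>

lemma flips_root:
  assumes G: "G \<subseteq> \<Union>H" "x \<in> G" "y \<in> G"
    and C: "C \<in> comps (G - {x})" "y \<in> C" and D: "D \<in> comps (G - {y})" "x \<in> D"
    and F: "\<And>E. E \<noteq> {} \<Longrightarrow> E \<subseteq> G \<Longrightarrow> con E (F E)"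
  shows "flips H x y
    (branch {x} (comps (G - {x})) (F(C := branch {y} (comps (C - {y})) F)))
    (branch {y} (comps (G - {y})) (F(D := branch {x} (comps (D - {x})) F)))"
proof -
  have Gx: "G - {x} \<subseteq> \<Union>H" and Gy: "G - {y} \<subseteq> \<Union>H" and Gxy: "G - {x} - {y} \<subseteq> \<Union>H"
    using G by auto
  note CD = compsD[OF C(1) Gx] and DD = compsD[OF D(1) Gy]
  have Cy: "C - {y} \<subseteq> \<Union>H" and Dx: "D - {x} \<subseteq> \<Union>H" using CD(4) DD(4) by auto
  let ?t = "branch {y} (comps (C - {y})) F"
  let ?F = "F(C := ?t)"
  let ?us = "Abs_fset (F ` comps (C - {y}))"
  let ?ts = "Abs_fset (?F ` comps (G - {x}))"
  let ?cs = "?us |\<union>| (?ts |-| {|Node {y} ?us|})"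
  have t: "Node {y} ?us = ?t" by (simp add: branch_def)
  have Cy': "con E (F E)" if "E \<in> comps (C - {y})" for E
  proof (rule F)
    show "E \<noteq> {}" "E \<subseteq> G" using compsD(1,2)[OF that Cy] CD(2) by auto
  qed
  have cont: "con C ?t" using CD C(2) Cy' by (intro con_branch) simp_all
  have conF: "con E (?F E)" if "E \<in> comps (G - {x})" for E
  proof (cases "E = C")
    case False
    have "E \<noteq> {}" "E \<subseteq> G" using compsD(1,2)[OF that Gx] by auto
    then show ?thesis using F[of E] False by simp
  qed (simp add: cont)
  have conG: "con G (branch {x} (comps (G - {x})) ?F)"
    using G conF by (intro con_branch) simp_all
  have fin: "finite (comps (G - {x}))" using finite_comps[OF Gx] .
  have "?F E \<noteq> ?t" if "E \<in> comps (G - {x}) - {C}" for E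
    using con_support[OF conF[of E]] con_support[OF cont] that by auto
  then have "?F ` comps (G - {x}) - {?t} = F ` (comps (G - {x}) - {C})" by auto
  \<comment> \<open>The pieces that the flip redistributes are the members of \<open>F\<close> on
    the components of \<open>G\<close> without \<open>x\<close> and \<open>y\<close>.\<close>
  then have cs: "fset ?cs = F ` comps (G - {x} - {y})"
    unfolding t using comps_minus[OF C(1) _ Gx, of "{y}"] C(2)
    by (simp add: fset_Abs_image[OF fin] fset_Abs_image[OF finite_comps[OF Cy]] image_Un del: fun_upd_apply)
  \<comment> \<open>Deleting \<open>y\<close> first lets the same components be sorted by
    \<open>D\<close>, as the filters require, instead of by \<open>C\<close>.\<close>
  have eq: "G - {x} - {y} = G - {y} - {x}" by blast
  have sup: "support (F E) = E" if "E \<in> comps (G - {x} - {y})" for E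
  proof (rule con_support[OF F])
    show "E \<noteq> {}" "E \<subseteq> G" using compsD(1,2)[OF that Gxy] by auto
  qed
  have sub: "{E \<in> comps (G - {x} - {y}). E \<subseteq> D} = comps (D - {x})"
    "{E \<in> comps (G - {x} - {y}). \<not> E \<subseteq> D} = comps (G - {y}) - {D}"
    unfolding eq using comps_subset_minus[OF D(1) _ Gy, of "{x}"] D(2) by auto
  have "fset (ffilter (\<lambda>c. support c \<subseteq> D) ?cs) = F ` {E \<in> comps (G - {x} - {y}). E \<subseteq> D}"
    using sup unfolding ffilter.rep_eq cs by auto
  then have A: "Node {x} (ffilter (\<lambda>c. support c \<subseteq> D) ?cs) = branch {x} (comps (D - {x})) F"
    unfolding sub by (intro Node_eq_branch finite_comps[OF Dx])
  have B: "fset (ffilter (\<lambda>c. \<not> support c \<subseteq> D) ?cs) = F ` {E \<in> comps (G - {x} - {y}). \<not> E \<subseteq> D}"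
    using sup unfolding ffilter.rep_eq cs by auto
  have "Node {y} (finsert (Node {x} (ffilter (\<lambda>c. support c \<subseteq> D) ?cs))
      (ffilter (\<lambda>c. \<not> support c \<subseteq> D) ?cs))
    = branch {y} (comps (G - {y})) (F(D := branch {x} (comps (D - {x})) F))"
  proof (rule Node_eq_branch[OF finite_comps[OF Gy]])
    have "insert (branch {x} (comps (D - {x})) F) (F ` (comps (G - {y}) - {D}))
      = (F(D := branch {x} (comps (D - {x})) F)) ` comps (G - {y})" using D(1) by auto
    then show "fset (finsert (Node {x} (ffilter (\<lambda>c. support c \<subseteq> D) ?cs))
        (ffilter (\<lambda>c. \<not> support c \<subseteq> D) ?cs))
      = (F(D := branch {x} (comps (D - {x})) F)) ` comps (G - {y})"
      unfolding A finsert.rep_eq B sub .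
  qed
  moreover have "flips H x y (Node {x} ?ts)
    (Node {y} (finsert (Node {x} (ffilter (\<lambda>c. support c \<subseteq> D) ?cs))
      (ffilter (\<lambda>c. \<not> support c \<subseteq> D) ?cs)))"
  proof (rule flips.root)
    show "Node {y} ?us |\<in>| ?ts" unfolding t fset_Abs_image[OF fin] using C(1) by force
    show "G = support (Node {x} ?ts)" using con_support[OF conG] unfolding branch_def by simp
    show "D \<in> hg_components (hg_minus (hg_restrict H G) {y})"
      using D(1) unfolding minus_restrict[OF G(1)] comps_def .
  qed (use D in simp_all)
  ultimately show ?thesis unfolding branch_def[of "{x}" "comps (G - {x})"] by simp
qed

text \<open>A flip is required in both directions, so that the same steps serve for maxima and minima.\<close>

definition fstep :: "('a \<Rightarrow> 'a \<Rightarrow> bool) \<Rightarrow> 'a set \<Rightarrow> 'a ltree \<Rightarrow> 'a ltree \<Rightarrow> bool" where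
  "fstep r G S T \<longleftrightarrow> cns G S \<and> cns G T \<and> (\<exists>x y. r y x \<and> flips H x y S T \<and> flips H y x T S)"

lemma fsteps_branch:
  assumes G: "G \<subseteq> \<Union>H" "y \<in> G"
    and F: "\<And>C. C \<in> comps (G - {y}) \<Longrightarrow> cns C (F C)"
    and f: "\<And>C. C \<in> comps (G - {y}) \<Longrightarrow> (fstep r C)\<^sup>*\<^sup>* (F C) (F' C)"
  shows "(fstep r G)\<^sup>*\<^sup>* (branch {y} (comps (G - {y})) F) (branch {y} (comps (G - {y})) F')"
proof -
  have Gy: "G - {y} \<subseteq> \<Union>H" using G by blast
  let ?K = "comps (G - {y})"
  have fin: "finite ?K" using finite_comps[OF Gy] .
  show ?thesis
  proof (rule branch_lift[OF fin, where P = cns and R = "fstep r"])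
    fix F C t assume F: "\<And>D. D \<in> ?K \<Longrightarrow> cns D (F D)" and C: "C \<in> ?K" and "fstep r C (F C) t"
    from this(3) obtain x z where r: "r z x" and f: "flips H x z (F C) t" "flips H z x t (F C)"
      and t: "cns C t" unfolding fstep_def by blast
    let ?F = "F(C := t)"
    have F': "cns D (?F D)" if "D \<in> ?K" for D using F t that by simp
    have s: "support (F D) = D" "support (?F D) = D" if "D \<in> ?K" for D
      using con_support[OF cns_con[OF F[OF that]]] con_support[OF cns_con[OF F'[OF that]]] by auto
    have "flips H x z (branch {y} ?K F) (branch {y} ?K ?F)"
      by (rule flips_branch[OF fin C s(1) f(1)])
    \<comment> \<open>Updating back to \<open>F C\<close> restores \<open>F\<close>, so the reverse
      flip is lifted in the same way.\<close>
    moreover have "flips H z x (branch {y} ?K ?F) (branch {y} ?K (?F(C := F C)))"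
      by (rule flips_branch[OF fin C s(2)]) (use f(2) in simp_all)
    ultimately show "fstep r G (branch {y} ?K F) (branch {y} ?K ?F)"
      using r cns_branch[OF G F] cns_branch[OF G F'] C unfolding fstep_def
      by (metis fun_upd_triv fun_upd_upd)
  next
    fix C t t' assume "fstep r C t t'"
    then show "cns C t'" unfolding fstep_def by blast
  qed (use F f in auto)
qed

lemma greedy_extreme:
  assumes sel: "selection r sel" and c: "coherent c"
  assumes "cns G T" "compat c T"
  shows "(fstep r G)\<^sup>*\<^sup>* T (build (greedy sel c) G)"
proof -
  have "finite G" using finite_subset_vertices[OF con_vertices[OF cns_con[OF assms(3)]]] .
  then show ?thesis using assms(3,4)
  proof (induction G arbitrary: T rule: finite_psubset_induct)
    case (psubset G)
    let ?M = "build (greedy sel c)"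
    have G: "G \<subseteq> \<Union>H" "G \<noteq> {}"
      using cns_con[OF psubset.prems(1)] con_vertices con_nonempty by auto
    have M: "cns E (?M E)" "compat c (?M E)" if "E \<noteq> {}" "E \<subseteq> G" for E
    proof -
      have "E \<subseteq> \<Union>H" using that G by blast
      then show "cns E (?M E)" "compat c (?M E)"
        using cns_build[OF sel c _ that(1)] compat_build_greedy[OF sel c _ that(1)] by simp_all
    qed
    have M_eq: "?M E = branch {sel (c E)} (comps (E - {sel (c E)})) ?M" if "E \<noteq> {}" "E \<subseteq> G" for E
    proof -
      have "E \<subseteq> \<Union>H" using that G by blast
      then show ?thesis
        using build_branch[OF greedy_proper[OF sel c] _ that(1)] unfolding greedy_def by simp
    qed
    obtain y F where y: "y \<in> G" and T: "T = branch {y} (comps (G - {y})) F"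
      and F: "\<And>C. C \<in> comps (G - {y}) \<Longrightarrow> cns C (F C)" using cns_cases[OF psubset.prems(1)] by blast
    have conT: "con G (branch {y} (comps (G - {y})) F)" using psubset.prems(1) T cns_con by blast
    have ycG: "y \<in> c G" and cF: "\<And>C. C \<in> comps (G - {y}) \<Longrightarrow> compat c (F C)"
      using psubset.prems(2) unfolding T compat_branch[OF conT] by auto
    have psub: "C \<subset> G" if "C \<in> comps (G - {z})" "z \<in> G" for C z
      using comp_psubset[OF that(1) G(1)] that(2) by blast
    have ne: "C \<noteq> {}" if "C \<in> comps (G - {z})" for C z
    proof -
      have "G - {z} \<subseteq> \<Union>H" using G by blast
      then show ?thesis using compsD(1)[OF that] by simp
    qed
    \<comment> \<open>The induction hypothesis applied to all children at once. The root is
      arbitrary because this is needed under the root \<open>y\<close> before the flip and under the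
      new root after it.\<close>
    have lift: "(fstep r G)\<^sup>*\<^sup>* (branch {z} (comps (G - {z})) F) (branch {z} (comps (G - {z})) ?M)"
      if z: "z \<in> G" and F: "\<And>C. C \<in> comps (G - {z}) \<Longrightarrow> cns C (F C) \<and> compat c (F C)" for z F
    proof (rule fsteps_branch[OF G(1) z])
      fix C assume C: "C \<in> comps (G - {z})"
      show "cns C (F C)" using F[OF C] by simp
      show "(fstep r C)\<^sup>*\<^sup>* (F C) (?M C)" using psubset.IH[OF psub[OF C z]] F[OF C] by simp
    qed
    let ?m = "sel (c G)"
    have cG: "finite (c G)" "c G \<subseteq> G"
      using coherentD(1)[OF c, of G] psubset.hyps by (auto intro: finite_subset)
    have m: "?m \<in> c G" using selectionD(1)[OF sel cG(1)] ycG by blast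
    then have mG: "?m \<in> G" using cG by blast
    have "(fstep r G)\<^sup>*\<^sup>* T (branch {y} (comps (G - {y})) ?M)"
      unfolding T using F cF by (intro lift y) auto
    also have "(fstep r G)\<^sup>*\<^sup>* (branch {y} (comps (G - {y})) ?M) (branch {?m} (comps (G - {?m})) ?M)"
    proof (cases "y = ?m")
      case True
      then show ?thesis by simp
    next
      case False
      \<comment> \<open>\<open>C\<close> is the component below \<open>y\<close> that carries the
        desired root; \<open>D\<close> is the component that will carry \<open>y\<close> once that
        root has been put on top.\<close>
      obtain C where C: "C \<in> comps (G - {y})" "?m \<in> C"
        using comps_cover[of ?m "G - {y}"] mG G False by blast
      obtain D where D: "D \<in> comps (G - {?m})" "y \<in> D"
        using comps_cover[of y "G - {?m}"] y G False by blast
      have CG: "C \<subset> G" "C \<noteq> {}" and DG: "D \<subset> G" "D \<noteq> {}"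
        using psub[OF C(1) y] psub[OF D(1) mG] ne C(1) D(1) by auto
      \<comment> \<open>By coherence and independence the extreme subtree on \<open>C\<close> has
        \<open>?m\<close> at its root, so \<open>?m\<close> is a child of \<open>y\<close> and can
        be flipped with it.\<close>
      have "c C = c G \<inter> C" using coherentD(3)[OF c, of C G] CG m C(2) by auto
      then have selC: "sel (c C) = ?m" using selectionD(3)[OF sel cG(1), of "c C"] m C(2) by blast
      have "?M C = branch {?m} (comps (C - {?m})) ?M" using M_eq[OF CG(2)] CG(1) selC by auto
      then have MC: "?M(C := branch {?m} (comps (C - {?m})) ?M) = ?M" by auto
      \<comment> \<open>The subtree on \<open>D\<close> right after the flip: its root is
        \<open>y\<close> and the subtrees below are extreme, but it need not itself be
        extreme.\<close>
      let ?t = "branch {y} (comps (D - {y})) ?M"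
      let ?F = "?M(D := ?t)"
      have DV: "D - {y} \<subseteq> \<Union>H" using DG G by blast
      have MD: "cns E (?M E) \<and> compat c (?M E)" if "E \<in> comps (D - {y})" for E
      proof -
        have "E \<noteq> {}" "E \<subseteq> G" using compsD(1,2)[OF that DV] DG by auto
        then show ?thesis using M by simp
      qed
      have ct: "cns D ?t"
      proof (rule cns_branch)
        show "D \<subseteq> \<Union>H" using DG G by blast
      qed (use D(2) MD in simp_all)
      \<comment> \<open>Coherence makes \<open>y\<close> an admissible root on \<open>D\<close>, so
        the flipped tree is still compatible with \<open>c\<close> and \<open>lift\<close> applies
        again.\<close>
      have "c D = c G \<inter> D" using coherentD(3)[OF c, of D G] DG ycG D(2) by auto
      then have "compat c ?t" unfolding compat_branch[OF cns_con[OF ct]] using MD ycG D(2) by simp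
      then have F: "cns E (?F E) \<and> compat c (?F E)" if "E \<in> comps (G - {?m})" for E
        using ct M[OF ne[OF that]] psub[OF that mG] by (cases "E = D") auto
      have conM: "con E (?M E)" if "E \<noteq> {}" "E \<subseteq> G" for E using cns_con[OF M(1)[OF that]] .
      have "flips H y ?m (branch {y} (comps (G - {y})) ?M) (branch {?m} (comps (G - {?m})) ?F)"
        using flips_root[OF G(1) y mG C D conM] unfolding MC .
      moreover have "flips H ?m y (branch {?m} (comps (G - {?m})) ?F) (branch {y} (comps (G - {y})) ?M)"
        using flips_root[OF G(1) mG y D C conM] unfolding MC .
      moreover have "cns G (branch {y} (comps (G - {y})) ?M)"
        using M(1)[OF ne] psub[OF _ y] by (intro cns_branch G y) blast
      moreover have "cns G (branch {?m} (comps (G - {?m})) ?F)"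
        using F by (intro cns_branch G mG) simp
      moreover have "r ?m y" using selectionD(2)[OF sel cG(1) ycG False] .
      ultimately have "fstep r G (branch {y} (comps (G - {y})) ?M) (branch {?m} (comps (G - {?m})) ?F)"
        unfolding fstep_def by blast
      also have "(fstep r G)\<^sup>*\<^sup>* (branch {?m} (comps (G - {?m})) ?F) (branch {?m} (comps (G - {?m})) ?M)"
        using F by (intro lift mG)
      finally show ?thesis .
    qed
    also have "branch {?m} (comps (G - {?m})) ?M = ?M G" using M_eq[of G] G by simp
    finally show ?case .
  qed
qed

end

section \<open>The facial weak order\<close>

lemma selection_Min: "selection (<) (Min :: 'a::linorder set \<Rightarrow> 'a)"
proof -
  have "Min Q < q" if "finite Q" "q \<in> Q" "q \<noteq> Min Q" for Q and q :: 'a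
    using Min_le[OF that(1,2)] that(3) by simp
  moreover have "Min Q' = Min Q" if Q: "finite Q" "Q' \<subseteq> Q" "Min Q \<in> Q'" for Q Q' :: "'a set"
    using finite_subset[OF Q(2,1)] Q Min_le by (intro Min_eqI) auto
  ultimately show ?thesis using Min_in by (intro selectionI)
qed

lemma selection_Max: "selection (>) (Max :: 'a::linorder set \<Rightarrow> 'a)"
proof -
  have "q < Max Q" if "finite Q" "q \<in> Q" "q \<noteq> Max Q" for Q and q :: 'a
    using Max_ge[OF that(1,2)] that(3) by simp
  moreover have "Max Q' = Max Q" if Q: "finite Q" "Q' \<subseteq> Q" "Max Q \<in> Q'" for Q Q' :: "'a set"
    using finite_subset[OF Q(2,1)] Q Max_ge by (intro Max_eqI) auto
  ultimately show ?thesis using Max_in by (intro selectionI)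
qed

lemma Max_in_upper:
  assumes "set_less V U" "finite U" "finite V" "finite Q" "Q \<subseteq> U \<union> V" "Q \<inter> U \<noteq> {}"
  shows "Max Q \<in> U"
proof (rule ccontr)
  assume "Max Q \<notin> U"
  moreover have "Max Q \<in> Q" using assms(4,6) by (intro Max_in) auto
  ultimately have "Max Q \<in> V" using assms(5) by blast
  then have "Max Q \<le> Max V" using assms(3) by simp
  also have "Max V < Min U" using assms(1) unfolding set_less_def .
  finally have less: "Max Q < Min U" .
  obtain u where u: "u \<in> Q" "u \<in> U" using assms(6) by blast
  then have "Min U \<le> u" "u \<le> Max Q" using assms(2,4) by simp_all
  then show False using less by simp
qed

lemma Min_in_lower:
  assumes "set_less V U" "finite U" "finite V" "finite Q" "Q \<subseteq> V \<union> U" "Q \<inter> V \<noteq> {}"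
  shows "Min Q \<in> V"
proof (rule ccontr)
  assume "Min Q \<notin> V"
  moreover have "Min Q \<in> Q" using assms(4,6) by (intro Min_in) auto
  ultimately have "Min Q \<in> U" using assms(5) by blast
  then have "Min U \<le> Min Q" using assms(2) by simp
  moreover have "Max V < Min U" using assms(1) unfolding set_less_def .
  ultimately have less: "Max V < Min Q" by simp
  obtain v where v: "v \<in> Q" "v \<in> V" using assms(6) by blast
  then have "v \<le> Max V" "Min Q \<le> v" using assms(3,4) by simp_all
  then show False using less by simp
qed

section \<open>Extreme constructions below a construct\<close>

locale ordered_hypergraph = finite_hypergraph H for H :: "'a::linorder set set"
begin

lemma construct_con: "construct H T \<longleftrightarrow> con (\<Union>H) T"
proof -
  have "hg_restrict H (\<Union>H) = H" unfolding hg_restrict_def by blast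
  then show ?thesis unfolding con_def by simp
qed

lemma construction_cns: "construction H T \<longleftrightarrow> cns (\<Union>H) T"
  unfolding construction_def cns_def construct_con ..

lemma fstep_less: "fstep (<) (\<Union>H) S T \<Longrightarrow> flip_step H S T"
  unfolding fstep_def flip_step_def construction_cns by blast

lemma fstep_greater: "fstep (>) (\<Union>H) S T \<Longrightarrow> flip_step H T S"
  unfolding fstep_def flip_step_def construction_cns by blast

definition greedy_of :: "('a set \<Rightarrow> 'a) \<Rightarrow> ('a set \<Rightarrow> 'a set) \<Rightarrow> 'a ltree" where
  "greedy_of sel c = build (greedy sel c) (\<Union>H)"

lemma greedy_below:
  assumes "selection r sel" "coherent c" "con (\<Union>H) S" "exact c S"
  shows "greedy_of sel c \<in> constructions_below H S"
proof -
  have ne: "\<Union>H \<noteq> {}" using con_nonempty[OF assms(3)] .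
  have "cns (\<Union>H) (greedy_of sel c)" "compat c (greedy_of sel c)"
    unfolding greedy_of_def
    using cns_build[OF assms(1,2) subset_refl ne] compat_build_greedy[OF assms(1,2) subset_refl ne] .
  then show ?thesis
    using compat_face[OF assms(2) cns_con, of "\<Union>H"] build_eqI[OF assms(3,4)]
    unfolding constructions_below_def construction_cns by simp
qed

lemma flip_max_greedy:
  assumes c: "coherent c" and S: "con (\<Union>H) S" "exact c S"
  shows "flip_max H S (greedy_of Min c)"
proof -
  have "flip_le H T (greedy_of Min c)" if "T \<in> constructions_below H S" for T
  proof -
    have T: "cns (\<Union>H) T" "face T S"
      using that unfolding constructions_below_def construction_cns by auto
    then have "compat c T" using face_compat[OF c T(2)] exact_imp_compat[OF S(2)] by blast
    \<comment> \<open>Each step raises a smaller vertex above a larger one, so the path ascends in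
      the flip order.\<close>
    then have "(fstep (<) (\<Union>H))\<^sup>*\<^sup>* T (greedy_of Min c)"
      unfolding greedy_of_def using greedy_extreme[OF selection_Min c T(1)] by blast
    then show ?thesis unfolding flip_le_def by (rule mono_rtranclp[rule_format, rotated]) (rule fstep_less)
  qed
  then show ?thesis using greedy_below[OF selection_Min c S] unfolding flip_max_def by blast
qed

lemma flip_min_greedy:
  assumes c: "coherent c" and S: "con (\<Union>H) S" "exact c S"
  shows "flip_min H S (greedy_of Max c)"
proof -
  have "flip_le H (greedy_of Max c) T" if "T \<in> constructions_below H S" for T
  proof -
    have T: "cns (\<Union>H) T" "face T S"
      using that unfolding constructions_below_def construction_cns by auto
    then have "compat c T" using face_compat[OF c T(2)] exact_imp_compat[OF S(2)] by blast
    \<comment> \<open>These steps raise larger vertices, so the path descends from \<open>T\<close>;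
      its reverse flips, read backwards, ascend to \<open>T\<close>.\<close>
    then have "(fstep (>) (\<Union>H))\<^sup>*\<^sup>* T (greedy_of Max c)"
      unfolding greedy_of_def using greedy_extreme[OF selection_Max c T(1)] by blast
    then show ?thesis unfolding flip_le_def
    proof (induction rule: rtranclp_induct)
      case (step U W)
      then show ?case using fstep_greater by (meson converse_rtranclp_into_rtranclp)
    qed simp
  qed
  then show ?thesis using greedy_below[OF selection_Max c S] unfolding flip_min_def by blast
qed

lemma below_facet:
  assumes "facet S T"
  shows "constructions_below H S \<subseteq> constructions_below H T"
  using assms unfolding constructions_below_def face_def by (auto intro: rtranclp.rtrancl_into_rtrancl)

text \<open>Shows that an extreme of the contracted construct already lies below \<open>S\<close>.
  Where \<open>c\<close> chooses something in \<open>X\<close>, the choice lies within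
  \<open>X \<union> Y\<close>, and \<open>sel\<close> then picks from \<open>X\<close>, as the rule
  of \<open>S\<close> demands; elsewhere focusing on \<open>X\<close> changes nothing.\<close>

lemma greedy_face:
  assumes sel: "selection r sel" and c: "coherent c" and S: "con (\<Union>H) S" "exact (focus X c) S"
    and level: "\<And>D. c D \<inter> X \<noteq> {} \<Longrightarrow> c D \<subseteq> X \<union> Y"
    and pref: "\<And>Q. finite Q \<Longrightarrow> Q \<subseteq> X \<union> Y \<Longrightarrow> Q \<inter> X \<noteq> {} \<Longrightarrow> sel Q \<in> X"
  shows "face (greedy_of sel c) S"
proof -
  have ne: "\<Union>H \<noteq> {}" using con_nonempty[OF S(1)] .
  note b = build[OF greedy_proper[OF sel c] subset_refl ne, folded greedy_of_def]
  have "greedy sel c D \<subseteq> focus X c D" if D: "D \<subseteq> \<Union>H" "D \<noteq> {}" for D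
  proof (cases "c D \<inter> X = {}")
    case True
    then show ?thesis using greedy_subset[OF sel c D] unfolding focus_def by simp
  next
    case False
    have "finite (c D)"
      using coherentD(1)[OF c, of D] finite_subset_vertices D(1) by (meson subset_trans)
    then have "sel (c D) \<in> X" using pref[OF _ level[OF False] False] by simp
    then show ?thesis using greedy_subset[OF sel c D] False unfolding focus_def greedy_def by simp
  qed
  then have "compat (focus X c) (greedy_of sel c)" using exact_compat[OF b] by blast
  then show ?thesis
    using compat_face[OF coherent_focus[OF c, of X] b(1)] build_eqI[OF S] by simp
qed

text \<open>If it were below \<open>S\<close>, it would be below \<open>T\<close> and hence have the
  support of the merged node among its tubes. Its label there is the vertex selected from
  \<open>X \<union> Y\<close>, whereas the rule of \<open>S\<close> admits only vertices of
  \<open>X\<close>.\<close>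

lemma greedy_not_face:
  assumes sel: "selection r sel" and c: "coherent c"
    and S: "con (\<Union>H) S" "exact (focus X c) S" and T: "con (\<Union>H) T" "exact c T"
    and contr: "contracts X Y S T" and notin: "sel (X \<union> Y) \<notin> X"
  shows "\<not> face (greedy_of sel c) S"
proof
  assume f: "face (greedy_of sel c) S"
  have ne: "\<Union>H \<noteq> {}" using con_nonempty[OF S(1)] .
  note b = build[OF greedy_proper[OF sel c] subset_refl ne, folded greedy_of_def]
  have comp: "compat (focus X c) (greedy_of sel c)"
    using face_compat[OF coherent_focus[OF c] f] exact_imp_compat[OF S(2)] by blast
  obtain ts where ts: "Node (X \<union> Y) ts \<in> subtrees T" using contracts_merged[OF contr] by blast
  define D where "D = support (Node (X \<union> Y) ts)"
  have cD: "c D = X \<union> Y" using T(2) ts unfolding exact_def D_def by blast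
  have "D \<in> tubes T" using ts unfolding D_def tubes_def by blast
  moreover have "face (greedy_of sel c) T"
    using f contr rtranclp.rtrancl_into_rtrancl[of facet] unfolding face_def by (metis facet_def)
  ultimately have "D \<in> tubes (greedy_of sel c)" using face_tubes by blast
  then obtain Z us where Z: "Node Z us \<in> subtrees (greedy_of sel c)" "D = support (Node Z us)"
    unfolding tubes_def by (metis imageE ltree.exhaust)
  have "Z = greedy sel c D" using b(2) Z unfolding exact_def by blast
  moreover have "Z \<subseteq> focus X c D" using comp Z unfolding compat_def by blast
  moreover have "X \<noteq> {}" using contracts_labels[OF contr con_separated[OF S(1)]] by blast
  then have "focus X c D = X" unfolding focus_def cD by auto
  ultimately show False using notin unfolding greedy_def cD by simp
qed

text \<open>Focusing on \<open>X \<union> Y\<close> excludes ties with other nodes, so that \<open>X \<union> Y\<close> is a whole level.\<close>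

lemma contracts_choice:
  assumes "contracts X Y S T" "con (\<Union>H) S" "con (\<Union>H) T"
  obtains c where "coherent c" "exact c T" "exact (focus X c) S"
    "\<And>D. c D \<inter> X \<noteq> {} \<Longrightarrow> c D \<subseteq> X \<union> Y"
proof -
  obtain p where "exact (top_by p) T" using con_exact_exists[OF assms(3)] by blast
  then have "exact (focus (X \<union> Y) (top_by p)) T \<and>
      exact (focus X (focus (X \<union> Y) (top_by p))) S"
    by (rule contracts_exact[OF coherent_top_by assms(1) _ con_separated[OF assms(2)]])
  moreover have "focus (X \<union> Y) (top_by p) D \<subseteq> X \<union> Y"
    if "focus (X \<union> Y) (top_by p) D \<inter> X \<noteq> {}" for D
    using that unfolding focus_def by (auto split: if_splits)
  ultimately show ?thesis using that coherent_focus[OF coherent_top_by] by blast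
qed

section \<open>Fusions and splits\<close>

lemma contracts_finite:
  assumes "contracts X Y S T" "con (\<Union>H) S"
  shows "finite X" "finite Y"
  using contracts_label_subset[OF assms(1)] con_support[OF assms(2)] finite_vertices
  by (auto intro: finite_subset)

lemma fusion_fwo_step:
  assumes contr: "contracts U V S T" and S: "con (\<Union>H) S" and T: "con (\<Union>H) T"
    and less: "set_less V U"
  shows "fwo_step H S T"
proof -
  obtain c where c: "coherent c" "exact c T" "exact (focus U c) S"
    and level: "\<And>D. c D \<inter> U \<noteq> {} \<Longrightarrow> c D \<subseteq> U \<union> V"
    using contracts_choice[OF contr S T] by blast
  note fin = contracts_finite[OF contr S]
  note lab = contracts_labels[OF contr con_separated[OF S]]
  have facet: "facet S T" using contr unfolding facet_def by blast
  let ?m = "greedy_of Max c" and ?M = "greedy_of Min c" and ?N = "greedy_of Min (focus U c)"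
  have mT: "flip_min H T ?m" using flip_min_greedy[OF c(1) T c(2)] .
  have MT: "flip_max H T ?M" using flip_max_greedy[OF c(1) T c(2)] .
  have NS: "flip_max H S ?N" using flip_max_greedy[OF coherent_focus[OF c(1)] S c(3)] .
  have "face ?m S"
    by (rule greedy_face[OF selection_Max c(1) S c(3) level]) (use Max_in_upper[OF less fin] in auto)
  \<comment> \<open>The constructions below \<open>S\<close> are among those below \<open>T\<close>,
    so a minimum for \<open>T\<close> that lies below \<open>S\<close> is also the minimum for
    \<open>S\<close>.\<close>
  then have mS: "flip_min H S ?m"
    using mT below_facet[OF facet] unfolding flip_min_def constructions_below_def by blast
  have "Min (U \<union> V) \<in> V" using lab fin by (intro Min_in_lower[OF less]) auto
  then have "Min (U \<union> V) \<notin> U" using lab by blast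
  then have "\<not> face ?M S" by (rule greedy_not_face[OF selection_Min c(1) S c(3) T c(2) contr])
  \<comment> \<open>The maximum for \<open>S\<close> lies below \<open>S\<close> and the maximum for
    \<open>T\<close> does not; this makes the inequality strict.\<close>
  then have "?N \<noteq> ?M" using NS unfolding flip_max_def constructions_below_def by auto
  moreover have "flip_le H ?N ?M" using NS MT below_facet[OF facet] unfolding flip_max_def by blast
  ultimately have "flip_less H ?N ?M" unfolding flip_less_def by blast
  then show ?thesis unfolding fwo_step_def construct_con using S T mS NS mT MT facet by blast
qed

text \<open>Now the lower label \<open>V\<close> is the parent in the contracted edge.
  \<open>Min\<close> falls into it and \<open>Max\<close> does not, so the maxima agree and the
  minima differ.\<close>

lemma split_fwo_step:
  assumes contr: "contracts V U T S" and S: "con (\<Union>H) S" and T: "con (\<Union>H) T"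
    and less: "set_less V U"
  shows "fwo_step H S T"
proof -
  obtain c where c: "coherent c" "exact c S" "exact (focus V c) T"
    and level: "\<And>D. c D \<inter> V \<noteq> {} \<Longrightarrow> c D \<subseteq> V \<union> U"
    using contracts_choice[OF contr T S] by blast
  note fin = contracts_finite[OF contr T]
  note lab = contracts_labels[OF contr con_separated[OF T]]
  have facet: "facet T S" using contr unfolding facet_def by blast
  let ?M = "greedy_of Min c" and ?m = "greedy_of Max c" and ?n = "greedy_of Max (focus V c)"
  have MS: "flip_max H S ?M" using flip_max_greedy[OF c(1) S c(2)] .
  have mS: "flip_min H S ?m" using flip_min_greedy[OF c(1) S c(2)] .
  have nT: "flip_min H T ?n" using flip_min_greedy[OF coherent_focus[OF c(1)] T c(3)] .
  have "face ?M T"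
    by (rule greedy_face[OF selection_Min c(1) T c(3) level]) (use Min_in_lower[OF less fin(2,1)] in auto)
  then have MT: "flip_max H T ?M"
    using MS below_facet[OF facet] unfolding flip_max_def constructions_below_def by blast
  have "Max (V \<union> U) \<in> U" using lab fin by (intro Max_in_upper[OF less]) auto
  then have "Max (V \<union> U) \<notin> V" using lab by blast
  then have "\<not> face ?m T" by (rule greedy_not_face[OF selection_Max c(1) T c(3) S c(2) contr])
  then have "?m \<noteq> ?n" using nT unfolding flip_min_def constructions_below_def by auto
  moreover have "flip_le H ?m ?n" using mS nT below_facet[OF facet] unfolding flip_min_def by blast
  ultimately have "flip_less H ?m ?n" unfolding flip_less_def by blast
  then show ?thesis unfolding fwo_step_def construct_con using S T mS MS nT MT facet by blast
qed

lemma gfo_step_fwo_step: "gfo_step H S T \<Longrightarrow> fwo_step H S T"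
  unfolding gfo_step_def construct_con using fusion_fwo_step split_fwo_step by blast

end

theorem proposition5p4:
  fixes H :: "'a::linorder set set" and S T :: "'a ltree"
  assumes "hypergraph H" and "hg_connected H"
    and "construct H S" and "construct H T"
    and "gfo H S T"
  shows "fwo H S T"
proof -
  interpret ordered_hypergraph H by unfold_locales (rule assms(1))
  show ?thesis using assms(5) unfolding gfo_def fwo_def
  proof (induction rule: rtranclp_induct)
    case (step T U)
    then show ?case using gfo_step_fwo_step by (meson rtranclp.rtrancl_into_rtrancl)
  qed simp
qed

end
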